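(* Let $\check R_1(z)$ be a Yang--Baxter operator on $V^{\pi_1}$, let a quasi-unique connecting system $\Sigma_{\pi_2}$ for $\pi_2$ be given, and let $\widetilde C\in\Gamma(\pi\times\pi,\overline{\operatorname{Hom}}(V^{\pi_1},V^{\pi_2}))$ be a cell-twist, with associated operator $(\check R_2)_\lhd$ on $V^{\pi_2}\otimes V^{\pi_2}$. Assign a one dimensional vector space $V^\pi_\beta=\mathbb Ce_\beta$ to each $\beta\in\pi$, forming $V^\pi$. Then $\widetilde C$ gives rise to an intertwiner $C\in\operatorname{Hom}(V^{\pi_1}\otimes V^\pi,V^\pi\otimes V^{\pi_2})$: the map $$C(x\otimes e_{\beta_1})=\sum_{\beta_2\in\pi:\ s_\pi(\beta_2)=s(\alpha)}e_{\beta_2}\otimes\widetilde C(\beta_1,\beta_2)x,\qquad x\in V^{\pi_1}_\alpha,\ t(\alpha)=s_\pi(\beta_1),$$ satisfies, on $V^{\pi_1}\otimes V^{\pi_1}\otimes V^\pi$, $$C^{(12)}C^{(23)}\check R_1(z)^{(12)}=(\check R_2)_\lhd(z)^{(23)}C^{(12)}C^{(23)}.$$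
   Context: The ground field is $k=\mathbb C$. $\pi_1,\pi_2$ are groupoids and $V^{\pi_i}=(V^{\pi_i}_\alpha)_{\alpha\in\pi_i}$ is a family of finite dimensional vector spaces such that for each object only finitely many arrows with that source or target have nonzero component. $(V\otimes W)_\gamma=\bigoplus_{\beta\circ\alpha=\gamma}V_\alpha\otimes W_\beta$ ($\beta\circ\alpha$: first $\alpha$, then $\beta$). A Yang--Baxter operator on $V^{\pi_1}$ is a meromorphic function $z\mapsto\check R_1(z)$ with values in degree-preserving endomorphisms of $V^{\pi_1}\otimes V^{\pi_1}$ satisfying $\check R(z-w)^{(23)}\check R(z)^{(12)}\check R(w)^{(23)}=\check R(w)^{(12)}\check R(z)^{(23)}\check R(z-w)^{(12)}$ and $\check R(z)\check R(-z)=\mathrm{id}$ (superscripts: tensor factors acted on). $\pi$ is a set with surjective maps $s_\pi:\pi\to\mathrm{Ob}(\pi_1)$, $t_\pi:\pi\to\mathrm{Ob}(\pi_2)$, with only finitely many elements of any given source or target. Tensor products such as $V^{\pi_1}\otimes V^\pi$ and $V^\pi\otimes V^{\pi_2}$ are direct sums over composable strings of arrows; $\operatorname{Hom}$ means linear maps preserving source (in $\mathrm{Ob}(\pi_1)$) and target (in $\mathrm{Ob}(\pi_2)$) of strings. For objects $x,y$ of $\pi_i$ write $(V^{\pi_i})^{\otimes m}[x,y]=\bigoplus V^{\pi_i}_{\alpha_1}\otimes\cdots\otimes V^{\pi_i}_{\alpha_m}$, the sum over composable strings $x\xrightarrow{\alpha_1}\cdots\xrightarrow{\alpha_m}y$.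 Elements $f\in\Gamma(\pi\times\pi,\overline{\operatorname{Hom}}((V^{\pi_1})^{\otimes m},(V^{\pi_2})^{\otimes m}))$ are families of linear maps $f(\beta_1,\beta_2):(V^{\pi_1})^{\otimes m}[s_\pi(\beta_2),s_\pi(\beta_1)]\to(V^{\pi_2})^{\otimes m}[t_\pi(\beta_2),t_\pi(\beta_1)]$ (extended by zero to other strings where necessary), and elements $g\in\Gamma(\pi\times\pi,\overline{\operatorname{Hom}}((V^{\pi_2})^{\otimes m},(V^{\pi_1})^{\otimes m}))$ are families $g(\beta_1,\beta_2):(V^{\pi_2})^{\otimes m}[t_\pi(\beta_1),t_\pi(\beta_2)]\to(V^{\pi_1})^{\otimes m}[s_\pi(\beta_1),s_\pi(\beta_2)]$. Fusion: $(f*_\otimes f')(\beta_1,\beta_2)=\sum_\beta f(\beta,\beta_2)\otimes f'(\beta_1,\beta)$, $(g*_\otimes g')(\beta_1,\beta_2)=\sum_\beta g(\beta_1,\beta)\otimes g'(\beta,\beta_2)$. $f$ is invertible with inverse $g=f^{-1}$ if (a) for all $\beta_1,\beta_2$ with $t_\pi(\beta_1)=t_\pi(\beta_2)$ and all $x$: $\sum_{\beta:\,s_\pi(\beta)=x}g(\beta,\beta_2)f(\beta_1,\beta)=\delta_{\beta_1,\beta_2}\mathrm{id}$ on $(V^{\pi_1})^{\otimes m}[x,s_\pi(\beta_1)]$; (b) for all $\beta_1,\beta_2$ with $s_\pi(\beta_1)=s_\pi(\beta_2)$ and all $c'$: $\sum_{\beta:\,t_\pi(\beta)=c'}f(\beta,\beta_2)g(\beta_1,\beta)=\delta_{\beta_1,\beta_2}\mathrm{id}$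 on $(V^{\pi_2})^{\otimes m}[t_\pi(\beta_1),c']$. A connecting system $\Sigma_{\pi_2}\subset\pi$ for $\pi_2$ contains exactly one element $\beta_c$ with $t_\pi(\beta_c)=c$ for each $c\in\mathrm{Ob}(\pi_2)$. A path in $\pi_2$ is a (possibly empty) composable string of arrows with nonzero components of $V^{\pi_2}$. $\Sigma_{\pi_2}$ is quasi-unique if for each path $\gamma$ in $\pi_2$ there is a path $\gamma'$ with $t(\gamma')=s(\gamma)$ such that $\beta_1:=\beta_{s(\gamma')}$ satisfies $s_\pi^{-1}(s_\pi(\beta_1))=\{\beta_1\}$. Let $\widetilde C$ be invertible, $j=\widetilde C^{-1}*_\otimes\widetilde C^{-1}$, $j^{-1}=\widetilde C*_\otimes\widetilde C$. For $s_\pi(\beta_1)=s_\pi(\beta_2)$ let $\check R_2(\beta_1,\beta_2)$ be the map which on $(V^{\pi_2})^{\otimes 2}[t_\pi(\beta_1),c']$ is $\sum_{\beta:\,t_\pi(\beta)=c'}j^{-1}(\beta,\beta_2)\check R_1(z)j(\beta_1,\beta)$. $(\check R_2)_\lhd(z)$ is the operator on $V^{\pi_2}\otimes V^{\pi_2}$ equal to $\check R_2(\beta_c,\beta_c)$ on $(V^{\pi_2})^{\otimes2}[c,c']$. $\widetilde C$ is a cell-twist if it is invertible, $\check R_2(\beta_1,\beta_1)=\check R_2(\beta_1',\beta_1')$ whenever $t_\pi(\beta_1)=t_\pi(\beta_1')$, and $\check R_2(\beta_1,\beta_2)=0$ whenever $\beta_2\ne\beta_1$ and $s_\pi(\beta_2)=s_\pi(\beta_1)$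 (for all $z$). *)

theory Defs
  imports "HOL-Complex_Analysis.Complex_Analysis" "HOL-Library.Function_Algebras"
begin

section \<open>Vectors and tensors\<close>

text \<open>
  Vectors are complex-valued functions on an index type, and vector spaces are linear subspaces
  of such function spaces; every vector space \<open>W\<close> arises in this way, via
  \<open>w \<mapsto> (\<lambda>\<phi>. \<phi> w)\<close> on the linear functionals (or by coordinates).  The tensor product of
  two subspaces is the span of the product functions \<open>(p, q) \<mapsto> u p * v q\<close>.  Iterated tensor
  products are nested to the right.
\<close>

type_synonym 'k tvec = "'k \<Rightarrow> complex"

definition scl :: "complex \<Rightarrow> 'k tvec \<Rightarrow> 'k tvec" where
  "scl c u = (\<lambda>k. c * u k)"

global_interpretation fv: vector_space "scl :: complex \<Rightarrow> 'k tvec \<Rightarrow> 'k tvec"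
  by unfold_locales (auto simp: scl_def algebra_simps fun_eq_iff)

definition fin_dim :: "'k tvec set \<Rightarrow> bool" where
  "fin_dim W \<longleftrightarrow> (\<exists>B. finite B \<and> W = fv.span B)"

definition linear_on :: "'k tvec set \<Rightarrow> ('k tvec \<Rightarrow> 'l tvec) \<Rightarrow> bool" where
  "linear_on W f \<longleftrightarrow>
     (\<forall>u\<in>W. \<forall>v\<in>W. f (u + v) = f u + f v) \<and> (\<forall>c. \<forall>u\<in>W. f (scl c u) = scl c (f u))"

definition tens :: "'k tvec \<Rightarrow> 'l tvec \<Rightarrow> ('k \<times> 'l) tvec"  (infixr \<open>\<otimes>\<^sub>t\<close> 75) where
  "u \<otimes>\<^sub>t v = (\<lambda>(p, q). u p * v q)"

text \<open>
  Operators acting on some of the tensor factors.  They are computed slice by slice: freezing the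
  indices of the remaining factors turns a tensor in \<open>U \<otimes> W\<close> into a vector of \<open>U\<close>
  (respectively \<open>W\<close>).  For linear \<open>f\<close> this gives
  \<open>act_left f (u \<otimes>\<^sub>t w) = f u \<otimes>\<^sub>t w\<close> and \<open>act_right f (u \<otimes>\<^sub>t w) = u \<otimes>\<^sub>t f w\<close>.  On a threefold tensor
  product, \<open>act12 f\<close> is written \<open>f^(12)\<close> in the literature, and \<open>act23 f\<close> is \<open>f^(23)\<close>.
\<close>

definition act_left :: "('k tvec \<Rightarrow> 'm tvec) \<Rightarrow> ('k \<times> 'l) tvec \<Rightarrow> ('m \<times> 'l) tvec" where
  "act_left f t = (\<lambda>(p, q). f (\<lambda>p'. t (p', q)) p)"

definition act_right :: "('l tvec \<Rightarrow> 'm tvec) \<Rightarrow> ('k \<times> 'l) tvec \<Rightarrow> ('k \<times> 'm) tvec" where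
  "act_right f t = (\<lambda>(p, q). f (\<lambda>q'. t (p, q')) q)"

definition act12 ::
  "(('k \<times> 'l) tvec \<Rightarrow> ('m \<times> 'n) tvec) \<Rightarrow> ('k \<times> 'l \<times> 'r) tvec \<Rightarrow> ('m \<times> 'n \<times> 'r) tvec" where
  "act12 f t = (\<lambda>(p, q, r). f (\<lambda>(p', q'). t (p', q', r)) (p, q))"

definition act23 ::
  "(('k \<times> 'l) tvec \<Rightarrow> ('m \<times> 'n) tvec) \<Rightarrow> ('r \<times> 'k \<times> 'l) tvec \<Rightarrow> ('r \<times> 'm \<times> 'n) tvec" where
  "act23 f = act_right f"

definition map_tens ::
  "('k tvec \<Rightarrow> 'm tvec) \<Rightarrow> ('l tvec \<Rightarrow> 'n tvec) \<Rightarrow> ('k \<times> 'l) tvec \<Rightarrow> ('m \<times> 'n) tvec" where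
  "map_tens f g t = act_left f (act_right g t)"

text \<open>
  The sum of a family of vectors, possibly infinite but with only finitely many nonzero values at
  each index.
\<close>

definition lsum :: "'b set \<Rightarrow> ('b \<Rightarrow> 'k tvec) \<Rightarrow> 'k tvec" where
  "lsum A F = (\<lambda>k. \<Sum>b\<in>{b \<in> A. F b k \<noteq> 0}. F b k)"


section \<open>Spaces of strings\<close>

text \<open>
  A space of strings is given by its components \<open>H x y\<close>, spanned by the strings
  from \<open>x\<close> to \<open>y\<close>; the direct sum of the components is \<open>tot H\<close>.
\<close>

type_synonym ('o, 'q, 'k) strings = "'o \<Rightarrow> 'q \<Rightarrow> 'k tvec set"

definition tot :: "('o, 'q, 'k) strings \<Rightarrow> 'k tvec set" where
  "tot H = fv.span (\<Union>x y. H x y)"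

definition concat_tens ::
  "('o, 'q, 'k) strings \<Rightarrow> ('q, 'r, 'l) strings \<Rightarrow> ('o, 'r, 'k \<times> 'l) strings"
  (infixr \<open>\<odot>\<close> 75) where
  "(H \<odot> K) x z = fv.span {u \<otimes>\<^sub>t v | u v. \<exists>y. u \<in> H x y \<and> v \<in> K y z}"

text \<open>Linear maps preserving source and target of strings.\<close>

definition Hom :: "('o, 'q, 'k) strings \<Rightarrow> ('o, 'q, 'l) strings \<Rightarrow> ('k tvec \<Rightarrow> 'l tvec) set" where
  "Hom H K = {f. linear_on (tot H) f \<and> (\<forall>x y. f ` H x y \<subseteq> K x y)}"

text \<open>Linear maps \<open>H x y \<rightarrow> K x' y'\<close>, extended by zero to the other components of \<open>H\<close>.\<close>

definition block_Hom ::
  "('o, 'q, 'k) strings \<Rightarrow> 'o \<Rightarrow> 'q \<Rightarrow> ('o2, 'q2, 'l) strings \<Rightarrow> 'o2 \<Rightarrow> 'q2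
    \<Rightarrow> ('k tvec \<Rightarrow> 'l tvec) set" where
  "block_Hom H x y K x' y' =
     {f. linear_on (tot H) f \<and> f ` H x y \<subseteq> K x' y'
       \<and> (\<forall>v w. (v, w) \<noteq> (x, y) \<longrightarrow> (\<forall>u \<in> H v w. f u = 0))}"


section \<open>Groupoids and groupoid-graded vector spaces\<close>

text \<open>\<open>cmp G \<beta> \<alpha>\<close> is \<open>\<beta> \<circ> \<alpha>\<close>: first \<open>\<alpha>\<close>, then \<open>\<beta>\<close>.\<close>

record ('o, 'a) gpd =
  Ob :: "'o set"
  Arr :: "'a set"
  src :: "'a \<Rightarrow> 'o"
  tgt :: "'a \<Rightarrow> 'o"
  idt :: "'o \<Rightarrow> 'a"
  cmp :: "'a \<Rightarrow> 'a \<Rightarrow> 'a"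

locale groupoid =
  fixes G :: "('o, 'a) gpd"
  assumes src_closed: "\<alpha> \<in> Arr G \<Longrightarrow> src G \<alpha> \<in> Ob G"
    and tgt_closed: "\<alpha> \<in> Arr G \<Longrightarrow> tgt G \<alpha> \<in> Ob G"
    and idt_closed: "x \<in> Ob G \<Longrightarrow> idt G x \<in> Arr G"
    and src_idt: "x \<in> Ob G \<Longrightarrow> src G (idt G x) = x"
    and tgt_idt: "x \<in> Ob G \<Longrightarrow> tgt G (idt G x) = x"
    and cmp_closed: "\<lbrakk>\<alpha> \<in> Arr G; \<beta> \<in> Arr G; tgt G \<alpha> = src G \<beta>\<rbrakk> \<Longrightarrow> cmp G \<beta> \<alpha> \<in> Arr G"
    and src_cmp: "\<lbrakk>\<alpha> \<in> Arr G; \<beta> \<in> Arr G; tgt G \<alpha> = src G \<beta>\<rbrakk> \<Longrightarrow> src G (cmp G \<beta> \<alpha>) = src G \<alpha>"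
    and tgt_cmp: "\<lbrakk>\<alpha> \<in> Arr G; \<beta> \<in> Arr G; tgt G \<alpha> = src G \<beta>\<rbrakk> \<Longrightarrow> tgt G (cmp G \<beta> \<alpha>) = tgt G \<beta>"
    and cmp_assoc: "\<lbrakk>\<alpha> \<in> Arr G; \<beta> \<in> Arr G; \<gamma> \<in> Arr G; tgt G \<alpha> = src G \<beta>; tgt G \<beta> = src G \<gamma>\<rbrakk>
          \<Longrightarrow> cmp G \<gamma> (cmp G \<beta> \<alpha>) = cmp G (cmp G \<gamma> \<beta>) \<alpha>"
    and cmp_idt_right: "\<alpha> \<in> Arr G \<Longrightarrow> cmp G \<alpha> (idt G (src G \<alpha>)) = \<alpha>"
    and cmp_idt_left: "\<alpha> \<in> Arr G \<Longrightarrow> cmp G (idt G (tgt G \<alpha>)) \<alpha> = \<alpha>"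
    and inverse_ex: "\<alpha> \<in> Arr G \<Longrightarrow> \<exists>\<beta> \<in> Arr G. src G \<beta> = tgt G \<alpha> \<and> tgt G \<beta> = src G \<alpha>
          \<and> cmp G \<beta> \<alpha> = idt G (src G \<alpha>) \<and> cmp G \<alpha> \<beta> = idt G (tgt G \<alpha>)"

definition graded_space :: "('o, 'a) gpd \<Rightarrow> ('a \<Rightarrow> 'i tvec set) \<Rightarrow> bool" where
  "graded_space G V \<longleftrightarrow>
     (\<forall>\<alpha> \<in> Arr G. fin_dim (V \<alpha>)) \<and>
     (\<forall>x \<in> Ob G. finite {\<alpha> \<in> Arr G. (src G \<alpha> = x \<or> tgt G \<alpha> = x) \<and> V \<alpha> \<noteq> {0}})"

text \<open>
  The index type of the direct sum of all components \<open>V \<alpha>\<close> is the type of pairs of an arrow and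
  an index; \<open>in_deg \<alpha> v\<close> is \<open>v \<in> V \<alpha>\<close> placed in the summand of \<open>\<alpha>\<close>.
\<close>

definition in_deg :: "'a \<Rightarrow> 'i tvec \<Rightarrow> ('a \<times> 'i) tvec" where
  "in_deg \<alpha> v = (\<lambda>(\<alpha>', i). if \<alpha>' = \<alpha> then v i else 0)"

definition arrow_strings ::
  "('o, 'a) gpd \<Rightarrow> ('a \<Rightarrow> 'i tvec set) \<Rightarrow> ('o, 'o, 'a \<times> 'i) strings" where
  "arrow_strings G V x y =
     fv.span {in_deg \<alpha> v | \<alpha> v. \<alpha> \<in> Arr G \<and> src G \<alpha> = x \<and> tgt G \<alpha> = y \<and> v \<in> V \<alpha>}"

text \<open>The component of degree \<open>\<gamma>\<close> of \<open>V \<otimes> V\<close>.\<close>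

definition tens_deg ::
  "('o, 'a) gpd \<Rightarrow> ('a \<Rightarrow> 'i tvec set) \<Rightarrow> 'a \<Rightarrow> (('a \<times> 'i) \<times> ('a \<times> 'i)) tvec set" where
  "tens_deg G V \<gamma> =
     fv.span {in_deg \<alpha> v \<otimes>\<^sub>t in_deg \<beta> w | \<alpha> \<beta> v w.
       \<alpha> \<in> Arr G \<and> \<beta> \<in> Arr G \<and> tgt G \<alpha> = src G \<beta> \<and> cmp G \<beta> \<alpha> = \<gamma> \<and> v \<in> V \<alpha> \<and> w \<in> V \<beta>}"


section \<open>Yang--Baxter operators\<close>

text \<open>
  A meromorphic operator-valued function is defined outside a discrete closed set \<open>P\<close>; it is
  meromorphic if its matrix coefficients are holomorphic outside \<open>P\<close> and have no essential
  singularities in \<open>P\<close>.  Identities between such functions are required where all the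
  values of the functions occurring in them are defined; the values on \<open>P\<close> are irrelevant.
\<close>

definition yang_baxter_operator ::
  "('o, 'a) gpd \<Rightarrow> ('a \<Rightarrow> 'i tvec set) \<Rightarrow> complex set
    \<Rightarrow> (complex \<Rightarrow> (('a \<times> 'i) \<times> ('a \<times> 'i)) tvec \<Rightarrow> (('a \<times> 'i) \<times> ('a \<times> 'i)) tvec) \<Rightarrow> bool" where
  "yang_baxter_operator G V P R \<longleftrightarrow>
     (let E = arrow_strings G V in
       P sparse_in UNIV \<and>
       (\<forall>z. z \<notin> P \<longrightarrow> linear_on (tot (E \<odot> E)) (R z) \<and>
          (\<forall>\<gamma> \<in> Arr G. R z ` tens_deg G V \<gamma> \<subseteq> tens_deg G V \<gamma>)) \<and>
       (\<forall>t \<in> tot (E \<odot> E). \<forall>k.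
          (\<lambda>z. R z t k) meromorphic_on UNIV \<and> (\<lambda>z. R z t k) holomorphic_on (- P)) \<and>
       (\<forall>z w. z \<notin> P \<and> w \<notin> P \<and> z - w \<notin> P \<longrightarrow> (\<forall>t \<in> tot (E \<odot> E \<odot> E).
          act23 (R (z - w)) (act12 (R z) (act23 (R w) t)) =
          act12 (R w) (act23 (R z) (act12 (R (z - w)) t)))) \<and>
       (\<forall>z. z \<notin> P \<and> - z \<notin> P \<longrightarrow> (\<forall>t \<in> tot (E \<odot> E). R z (R (- z) t) = t)))"


section \<open>The set \<open>\<pi>\<close> and families of maps over it\<close>

record ('p, 'o, 'q) cells =
  Cells :: "'p set"
  csrc :: "'p \<Rightarrow> 'o"
  ctgt :: "'p \<Rightarrow> 'q"

definition cell_set :: "('o, 'a) gpd \<Rightarrow> ('q, 'b) gpd \<Rightarrow> ('p, 'o, 'q) cells \<Rightarrow> bool" where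
  "cell_set G1 G2 \<Xi> \<longleftrightarrow>
     csrc \<Xi> ` Cells \<Xi> = Ob G1 \<and> ctgt \<Xi> ` Cells \<Xi> = Ob G2 \<and>
     (\<forall>x \<in> Ob G1. finite {\<beta> \<in> Cells \<Xi>. csrc \<Xi> \<beta> = x}) \<and>
     (\<forall>c \<in> Ob G2. finite {\<beta> \<in> Cells \<Xi>. ctgt \<Xi> \<beta> = c})"

definition unit_vec :: "'p \<Rightarrow> 'p tvec" where
  "unit_vec \<beta> = (\<lambda>\<beta>'. if \<beta>' = \<beta> then 1 else 0)"

text \<open>The space \<open>V\<^sup>\<pi>\<close> with one dimensional components spanned by \<open>unit_vec \<beta>\<close>.\<close>

definition cell_strings :: "('p, 'o, 'q) cells \<Rightarrow> ('o, 'q, 'p) strings" where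
  "cell_strings \<Xi> x c = fv.span {unit_vec \<beta> | \<beta>. \<beta> \<in> Cells \<Xi> \<and> csrc \<Xi> \<beta> = x \<and> ctgt \<Xi> \<beta> = c}"

type_synonym ('p, 'k, 'l) family = "'p \<Rightarrow> 'p \<Rightarrow> 'k tvec \<Rightarrow> 'l tvec"

text \<open>
  In the following \<open>H1\<close> and \<open>H2\<close> stand for the \<open>m\<close>-fold tensor powers of the graded
  spaces over the two groupoids.  The two kinds of families \<open>f\<close> and \<open>g\<close>
  use opposite conventions for the order of the arguments; \<open>Fam\<close> and \<open>Fam_op\<close> are
  the spaces of sections usually denoted by a capital Gamma.
\<close>

definition Fam ::
  "('p, 'o, 'q) cells \<Rightarrow> ('o, 'o, 'k) strings \<Rightarrow> ('q, 'q, 'l) strings \<Rightarrow> ('p, 'k, 'l) family set"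
  where
  "Fam \<Xi> H1 H2 = {f. \<forall>\<beta>1 \<in> Cells \<Xi>. \<forall>\<beta>2 \<in> Cells \<Xi>.
     f \<beta>1 \<beta>2 \<in> block_Hom H1 (csrc \<Xi> \<beta>2) (csrc \<Xi> \<beta>1) H2 (ctgt \<Xi> \<beta>2) (ctgt \<Xi> \<beta>1)}"

definition Fam_op ::
  "('p, 'o, 'q) cells \<Rightarrow> ('o, 'o, 'k) strings \<Rightarrow> ('q, 'q, 'l) strings \<Rightarrow> ('p, 'l, 'k) family set"
  where
  "Fam_op \<Xi> H1 H2 = {g. \<forall>\<beta>1 \<in> Cells \<Xi>. \<forall>\<beta>2 \<in> Cells \<Xi>.
     g \<beta>1 \<beta>2 \<in> block_Hom H2 (ctgt \<Xi> \<beta>1) (ctgt \<Xi> \<beta>2) H1 (csrc \<Xi> \<beta>1) (csrc \<Xi> \<beta>2)}"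

definition fusion ::
  "('p, 'o, 'q) cells \<Rightarrow> ('p, 'k, 'l) family \<Rightarrow> ('p, 'm, 'n) family
    \<Rightarrow> ('p, 'k \<times> 'm, 'l \<times> 'n) family" where
  "fusion \<Xi> f f' \<beta>1 \<beta>2 t = lsum (Cells \<Xi>) (\<lambda>\<beta>. map_tens (f \<beta> \<beta>2) (f' \<beta>1 \<beta>) t)"

definition fusion_op ::
  "('p, 'o, 'q) cells \<Rightarrow> ('p, 'k, 'l) family \<Rightarrow> ('p, 'm, 'n) family
    \<Rightarrow> ('p, 'k \<times> 'm, 'l \<times> 'n) family" where
  "fusion_op \<Xi> g g' \<beta>1 \<beta>2 t = lsum (Cells \<Xi>) (\<lambda>\<beta>. map_tens (g \<beta>1 \<beta>) (g' \<beta> \<beta>2) t)"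

definition is_inverse ::
  "('o, 'a) gpd \<Rightarrow> ('q, 'b) gpd \<Rightarrow> ('p, 'o, 'q) cells \<Rightarrow> ('o, 'o, 'k) strings
    \<Rightarrow> ('q, 'q, 'l) strings \<Rightarrow> ('p, 'k, 'l) family \<Rightarrow> ('p, 'l, 'k) family \<Rightarrow> bool" where
  "is_inverse G1 G2 \<Xi> H1 H2 f g \<longleftrightarrow>
     g \<in> Fam_op \<Xi> H1 H2 \<and>
     (\<forall>\<beta>1 \<in> Cells \<Xi>. \<forall>\<beta>2 \<in> Cells \<Xi>. ctgt \<Xi> \<beta>1 = ctgt \<Xi> \<beta>2 \<longrightarrow>
       (\<forall>x \<in> Ob G1. \<forall>u \<in> H1 x (csrc \<Xi> \<beta>1).
         (\<Sum>\<beta> \<in> {\<beta> \<in> Cells \<Xi>. csrc \<Xi> \<beta> = x}. g \<beta> \<beta>2 (f \<beta>1 \<beta> u)) = (if \<beta>1 = \<beta>2 then u else 0))) \<and>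
     (\<forall>\<beta>1 \<in> Cells \<Xi>. \<forall>\<beta>2 \<in> Cells \<Xi>. csrc \<Xi> \<beta>1 = csrc \<Xi> \<beta>2 \<longrightarrow>
       (\<forall>c' \<in> Ob G2. \<forall>v \<in> H2 (ctgt \<Xi> \<beta>1) c'.
         (\<Sum>\<beta> \<in> {\<beta> \<in> Cells \<Xi>. ctgt \<Xi> \<beta> = c'}. f \<beta> \<beta>2 (g \<beta>1 \<beta> v)) = (if \<beta>1 = \<beta>2 then v else 0)))"

definition is_invertible ::
  "('o, 'a) gpd \<Rightarrow> ('q, 'b) gpd \<Rightarrow> ('p, 'o, 'q) cells \<Rightarrow> ('o, 'o, 'k) strings
    \<Rightarrow> ('q, 'q, 'l) strings \<Rightarrow> ('p, 'k, 'l) family \<Rightarrow> bool" where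
  "is_invertible G1 G2 \<Xi> H1 H2 f \<longleftrightarrow> (\<exists>g. is_inverse G1 G2 \<Xi> H1 H2 f g)"

text \<open>The inverse is unique as a family of maps on the spaces of strings.\<close>

definition inverse_family ::
  "('o, 'a) gpd \<Rightarrow> ('q, 'b) gpd \<Rightarrow> ('p, 'o, 'q) cells \<Rightarrow> ('o, 'o, 'k) strings
    \<Rightarrow> ('q, 'q, 'l) strings \<Rightarrow> ('p, 'k, 'l) family \<Rightarrow> ('p, 'l, 'k) family" where
  "inverse_family G1 G2 \<Xi> H1 H2 f = (SOME g. is_inverse G1 G2 \<Xi> H1 H2 f g)"


section \<open>Connecting systems\<close>

definition connecting_system :: "('q, 'b) gpd \<Rightarrow> ('p, 'o, 'q) cells \<Rightarrow> 'p set \<Rightarrow> bool" where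
  "connecting_system G2 \<Xi> S \<longleftrightarrow> S \<subseteq> Cells \<Xi> \<and> (\<forall>c \<in> Ob G2. \<exists>!\<beta>. \<beta> \<in> S \<and> ctgt \<Xi> \<beta> = c)"

definition conn :: "('p, 'o, 'q) cells \<Rightarrow> 'p set \<Rightarrow> 'q \<Rightarrow> 'p" where
  "conn \<Xi> S c = (THE \<beta>. \<beta> \<in> S \<and> ctgt \<Xi> \<beta> = c)"

fun is_path :: "('q, 'b) gpd \<Rightarrow> ('b \<Rightarrow> 'i tvec set) \<Rightarrow> 'q \<Rightarrow> 'b list \<Rightarrow> 'q \<Rightarrow> bool" where
  "is_path G V x [] y \<longleftrightarrow> x \<in> Ob G \<and> x = y"
| "is_path G V x (\<alpha> # as) y \<longleftrightarrow>
     \<alpha> \<in> Arr G \<and> V \<alpha> \<noteq> {0} \<and> src G \<alpha> = x \<and> is_path G V (tgt G \<alpha>) as y"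

definition quasi_unique ::
  "('q, 'b) gpd \<Rightarrow> ('b \<Rightarrow> 'i tvec set) \<Rightarrow> ('p, 'o, 'q) cells \<Rightarrow> 'p set \<Rightarrow> bool" where
  "quasi_unique G2 V2 \<Xi> S \<longleftrightarrow>
     (\<forall>x as y. is_path G2 V2 x as y \<longrightarrow>
       (\<exists>w bs. is_path G2 V2 w bs x \<and>
         {\<beta> \<in> Cells \<Xi>. csrc \<Xi> \<beta> = csrc \<Xi> (conn \<Xi> S w)} = {conn \<Xi> S w}))"


section \<open>Cell-twists\<close>

text \<open>
  \<open>twisted_R \<dots> R \<beta>1 \<beta>2 c'\<close> is the restriction of the twisted operator to the strings from
  \<open>ctgt \<Xi> \<beta>1\<close> to \<open>c'\<close>; here \<open>R\<close> is the value of the given operator at one spectral parameter.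
\<close>

definition twisted_R ::
  "('o, 'a) gpd \<Rightarrow> ('a \<Rightarrow> 'i tvec set) \<Rightarrow> ('q, 'b) gpd \<Rightarrow> ('b \<Rightarrow> 'j tvec set)
    \<Rightarrow> ('p, 'o, 'q) cells \<Rightarrow> ('p, 'a \<times> 'i, 'b \<times> 'j) family
    \<Rightarrow> ((('a \<times> 'i) \<times> ('a \<times> 'i)) tvec \<Rightarrow> (('a \<times> 'i) \<times> ('a \<times> 'i)) tvec)
    \<Rightarrow> 'p \<Rightarrow> 'p \<Rightarrow> 'q \<Rightarrow> (('b \<times> 'j) \<times> ('b \<times> 'j)) tvec \<Rightarrow> (('b \<times> 'j) \<times> ('b \<times> 'j)) tvec" where
  "twisted_R G1 V1 G2 V2 \<Xi> Ct R \<beta>1 \<beta>2 c' t =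
     (let Cinv = inverse_family G1 G2 \<Xi> (arrow_strings G1 V1) (arrow_strings G2 V2) Ct;
          j = fusion_op \<Xi> Cinv Cinv;
          jinv = fusion \<Xi> Ct Ct
      in \<Sum>\<beta> \<in> {\<beta> \<in> Cells \<Xi>. ctgt \<Xi> \<beta> = c'}. jinv \<beta> \<beta>2 (R (j \<beta>1 \<beta> t)))"

text \<open>The projection of \<open>V \<otimes> V\<close> to the component of strings from \<open>c\<close> to \<open>c'\<close>.\<close>

definition proj2 ::
  "('q, 'b) gpd \<Rightarrow> 'q \<Rightarrow> 'q \<Rightarrow> (('b \<times> 'j) \<times> ('b \<times> 'j)) tvec \<Rightarrow> (('b \<times> 'j) \<times> ('b \<times> 'j)) tvec" where
  "proj2 G c c' t =
     (\<lambda>(p, q). if src G (fst p) = c \<and> tgt G (fst q) = c' then t (p, q) else 0)"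

definition twisted_R_lhd ::
  "('o, 'a) gpd \<Rightarrow> ('a \<Rightarrow> 'i tvec set) \<Rightarrow> ('q, 'b) gpd \<Rightarrow> ('b \<Rightarrow> 'j tvec set)
    \<Rightarrow> ('p, 'o, 'q) cells \<Rightarrow> 'p set \<Rightarrow> ('p, 'a \<times> 'i, 'b \<times> 'j) family
    \<Rightarrow> ((('a \<times> 'i) \<times> ('a \<times> 'i)) tvec \<Rightarrow> (('a \<times> 'i) \<times> ('a \<times> 'i)) tvec)
    \<Rightarrow> (('b \<times> 'j) \<times> ('b \<times> 'j)) tvec \<Rightarrow> (('b \<times> 'j) \<times> ('b \<times> 'j)) tvec" where
  "twisted_R_lhd G1 V1 G2 V2 \<Xi> S Ct R t =
     lsum (Ob G2 \<times> Ob G2) (\<lambda>(c, c').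
       twisted_R G1 V1 G2 V2 \<Xi> Ct R (conn \<Xi> S c) (conn \<Xi> S c) c' (proj2 G2 c c' t))"

definition cell_twist ::
  "('o, 'a) gpd \<Rightarrow> ('a \<Rightarrow> 'i tvec set) \<Rightarrow> ('q, 'b) gpd \<Rightarrow> ('b \<Rightarrow> 'j tvec set)
    \<Rightarrow> ('p, 'o, 'q) cells \<Rightarrow> complex set
    \<Rightarrow> (complex \<Rightarrow> (('a \<times> 'i) \<times> ('a \<times> 'i)) tvec \<Rightarrow> (('a \<times> 'i) \<times> ('a \<times> 'i)) tvec)
    \<Rightarrow> ('p, 'a \<times> 'i, 'b \<times> 'j) family \<Rightarrow> bool" where
  "cell_twist G1 V1 G2 V2 \<Xi> P R Ct \<longleftrightarrow>
     (let E1 = arrow_strings G1 V1; E2 = arrow_strings G2 V2;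
          R2 = (\<lambda>z. twisted_R G1 V1 G2 V2 \<Xi> Ct (R z))
      in is_invertible G1 G2 \<Xi> E1 E2 Ct \<and>
         (\<forall>\<beta> \<in> Cells \<Xi>. \<forall>\<beta>' \<in> Cells \<Xi>. ctgt \<Xi> \<beta> = ctgt \<Xi> \<beta>' \<longrightarrow>
            (\<forall>z. z \<notin> P \<longrightarrow> (\<forall>c' \<in> Ob G2. \<forall>t \<in> (E2 \<odot> E2) (ctgt \<Xi> \<beta>) c'.
               R2 z \<beta> \<beta> c' t = R2 z \<beta>' \<beta>' c' t))) \<and>
         (\<forall>\<beta>1 \<in> Cells \<Xi>. \<forall>\<beta>2 \<in> Cells \<Xi>. \<beta>2 \<noteq> \<beta>1 \<and> csrc \<Xi> \<beta>2 = csrc \<Xi> \<beta>1 \<longrightarrow>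
            (\<forall>z. z \<notin> P \<longrightarrow> (\<forall>c' \<in> Ob G2. \<forall>t \<in> (E2 \<odot> E2) (ctgt \<Xi> \<beta>1) c'.
               R2 z \<beta>1 \<beta>2 c' t = 0))))"

end

theory Submission
  imports Defs
begin

text \<open>
  Write \<open>J \<beta> \<beta>' = \<Sum>\<gamma>. Ct \<gamma> \<beta>' \<otimes> Ct \<beta> \<gamma>\<close> for the fusion square of the cell-twist \<open>Ct\<close>, and
  \<open>J' \<beta>' \<beta> = \<Sum>\<gamma>. g \<beta>' \<gamma> \<otimes> g \<gamma> \<beta>\<close> for that of its inverse \<open>g\<close>.  The theorem rests on three
  observations.

  First, carrying \<open>e\<^sub>\<beta>\<close> past two arrows produces exactly the fusion square: for \<open>T\<close> a string of
  length two from \<open>x\<close> to the source of \<open>\<beta>\<close>, the map \<open>C^(12) C^(23)\<close> sends \<open>T \<otimes> e\<^sub>\<beta>\<close> to the sum of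
  \<open>e\<^sub>\<beta>\<^sub>' \<otimes> J \<beta> \<beta>' T\<close> over all \<open>\<beta>'\<close> with source \<open>x\<close> (\<open>double_intertwiner_fusion\<close>).  The intertwining
  relation therefore says that \<open>J \<beta> \<beta>' (R T)\<close> equals the twisted operator applied to \<open>J \<beta> \<beta>' T\<close>, for
  each such \<open>\<beta>'\<close>.

  Second, the fusion square is inverted by \<open>J'\<close>: the sum of \<open>J' \<beta>2 \<beta>'' (J \<beta> \<beta>2 T)\<close> over all \<open>\<beta>2\<close> with
  source \<open>x\<close> is \<open>T\<close> if \<open>\<beta>'' = \<beta>\<close> and \<open>0\<close> if \<open>\<beta>''\<close> is another cell with the same target
  (\<open>fusion_left_inverse\<close>).

  Third, let \<open>R2 \<beta>2 \<beta>'\<close> be the sum of \<open>J \<beta>'' \<beta>' R J' \<beta>2 \<beta>''\<close> over all \<open>\<beta>''\<close> with the target of \<open>\<beta>\<close>.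
  By the second point, the sum of \<open>R2 \<beta>2 \<beta>' (J \<beta> \<beta>2 T)\<close> over all \<open>\<beta>2\<close> with source \<open>x\<close> collapses to
  \<open>J \<beta> \<beta>' (R T)\<close>.  By the definition of a cell-twist its terms with \<open>\<beta>2 \<noteq> \<beta>'\<close> vanish, so that
  \<open>R2 \<beta>' \<beta>' (J \<beta> \<beta>' T) = J \<beta> \<beta>' (R T)\<close> (\<open>twist_absorbs_fusion\<close>).  A cell-twist also lets \<open>R2 \<beta>' \<beta>'\<close>
  depend only on the target of \<open>\<beta>'\<close>, so \<open>\<beta>'\<close> may be replaced by the member of the connecting system
  over that target; this turns \<open>R2 \<beta>' \<beta>'\<close> into the operator of the theorem.

  All operators are linear only on the spans of strings, and tensor factors are acted on slice by
  slice.  Most of the preparatory work shows that these operators respect the spans, after which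
  identities between them are checked on pure tensors of composable strings.
\<close>

section \<open>Linear maps on spans\<close>

lemma subspace_scl: "fv.subspace W \<longleftrightarrow>
    0 \<in> W \<and> (\<forall>u\<in>W. \<forall>v\<in>W. u + v \<in> W) \<and> (\<forall>c. \<forall>u\<in>W. scl c u \<in> W)"
  by (auto simp: fv.subspace_def)

lemma linear_onI:
  assumes "\<And>u v. u \<in> W \<Longrightarrow> v \<in> W \<Longrightarrow> f (u + v) = f u + f v"
    and "\<And>c u. u \<in> W \<Longrightarrow> f (scl c u) = scl c (f u)"
  shows "linear_on W f"
  using assms by (simp add: linear_on_def)

lemma linear_on_add: "linear_on W f \<Longrightarrow> u \<in> W \<Longrightarrow> v \<in> W \<Longrightarrow> f (u + v) = f u + f v"
  by (simp add: linear_on_def)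

lemma linear_on_scl: "linear_on W f \<Longrightarrow> u \<in> W \<Longrightarrow> f (scl c u) = scl c (f u)"
  by (simp add: linear_on_def)

lemma linear_on_0:
  assumes "linear_on W f" "0 \<in> W"
  shows "f 0 = 0"
  using linear_on_scl[OF assms, of 0] by simp

lemma linear_on_subset: "linear_on W f \<Longrightarrow> W' \<subseteq> W \<Longrightarrow> linear_on W' f"
  unfolding linear_on_def by (meson subsetD)

lemma linear_on_compose:
  assumes "linear_on W g" "linear_on U f" "g ` W \<subseteq> U"
  shows "linear_on W (\<lambda>t. f (g t))"
  using assms by (auto simp: linear_on_def image_subset_iff)

lemma linear_on_sum_maps:
  assumes "\<And>a. a \<in> A \<Longrightarrow> linear_on W (F a)"
  shows "linear_on W (\<lambda>t. \<Sum>a\<in>A. F a t)"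
proof (rule linear_onI)
  fix u v assume "u \<in> W" "v \<in> W"
  then show "(\<Sum>a\<in>A. F a (u + v)) = (\<Sum>a\<in>A. F a u) + (\<Sum>a\<in>A. F a v)"
    unfolding sum.distrib[symmetric] by (intro sum.cong) (simp_all only: linear_on_add[OF assms])
next
  fix c u assume "u \<in> W"
  then show "(\<Sum>a\<in>A. F a (scl c u)) = scl c (\<Sum>a\<in>A. F a u)"
    unfolding fv.scale_sum_right by (intro sum.cong) (simp_all only: linear_on_scl[OF assms])
qed

lemma linear_on_sum:
  assumes "linear_on W f" "fv.subspace W" "\<And>a. a \<in> A \<Longrightarrow> F a \<in> W"
  shows "f (\<Sum>a\<in>A. F a) = (\<Sum>a\<in>A. f (F a))"
proof (cases "finite A")
  case True
  then show ?thesis using assms(3)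
  proof (induction A rule: finite_induct)
    case empty
    then show ?case using linear_on_0[OF assms(1) fv.subspace_0[OF assms(2)]]
      by (simp only: sum.empty)
  next
    case (insert a A)
    then have "(\<Sum>a\<in>A. F a) \<in> W" using assms(2) by (intro fv.subspace_sum) auto
    then have "f (F a + (\<Sum>a\<in>A. F a)) = f (F a) + f (\<Sum>a\<in>A. F a)"
      using insert.prems by (intro linear_on_add[OF assms(1)]) auto
    then show ?case using insert.IH insert.prems by (simp only: sum.insert[OF insert.hyps]) simp
  qed
next
  case False
  then show ?thesis using linear_on_0[OF assms(1) fv.subspace_0[OF assms(2)]]
    by (simp only: sum.infinite[OF False])
qed

text \<open>
  The vectors of \<open>W\<close> that \<open>f\<close> sends into \<open>X\<close> form a subspace.  The domain \<open>W\<close> is kept apart from the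
  span of \<open>B\<close> so that one linear map on a whole space of strings can be tested on the generators of
  any one of its components.
\<close>

lemma linear_on_span_image:
  assumes f: "linear_on W f" and W: "fv.subspace W" and B: "B \<subseteq> W"
    and X: "fv.subspace X" and im: "\<And>b. b \<in> B \<Longrightarrow> f b \<in> X" and t: "t \<in> fv.span B"
  shows "f t \<in> X"
proof -
  have "fv.span B \<subseteq> W" using B W by (rule fv.span_minimal)
  moreover have "fv.span B \<subseteq> {t \<in> W. f t \<in> X}"
  proof (rule fv.span_minimal)
    show "fv.subspace {t \<in> W. f t \<in> X}"
    proof (rule fv.subspaceI; clarify)
      show "0 \<in> W \<and> f 0 \<in> X"
        using linear_on_0[OF f] fv.subspace_0[OF W] fv.subspace_0[OF X] by metis
      show "u + v \<in> W \<and> f (u + v) \<in> X" if "u \<in> W" "f u \<in> X" "v \<in> W" "f v \<in> X" for u v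
        using linear_on_add[OF f] fv.subspace_add[OF W] fv.subspace_add[OF X] that by metis
      show "scl c u \<in> W \<and> f (scl c u) \<in> X" if "u \<in> W" "f u \<in> X" for c u
        using linear_on_scl[OF f] fv.subspace_scale[OF W] fv.subspace_scale[OF X] that by metis
    qed
  qed (use B im in auto)
  ultimately show ?thesis using t by auto
qed

lemma linear_on_span_eq:
  assumes f: "linear_on W f" and g: "linear_on W g" and W: "fv.subspace W" and B: "B \<subseteq> W"
    and eq: "\<And>b. b \<in> B \<Longrightarrow> f b = g b" and t: "t \<in> fv.span B"
  shows "f t = g t"
proof -
  have "fv.span B \<subseteq> {t \<in> W. f t = g t}"
  proof (rule fv.span_minimal)
    show "fv.subspace {t \<in> W. f t = g t}"
    proof (rule fv.subspaceI; clarify)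
      show "0 \<in> W \<and> f 0 = g 0"
        using linear_on_0[OF f] linear_on_0[OF g] fv.subspace_0[OF W] by metis
      show "u + v \<in> W \<and> f (u + v) = g (u + v)"
        if "u \<in> W" "f u = g u" "v \<in> W" "f v = g v" for u v
        using linear_on_add[OF f] linear_on_add[OF g] fv.subspace_add[OF W] that by metis
      show "scl c u \<in> W \<and> f (scl c u) = g (scl c u)" if "u \<in> W" "f u = g u" for c u
        using linear_on_scl[OF f] linear_on_scl[OF g] fv.subspace_scale[OF W] that by metis
    qed
  qed (use B eq in auto)
  then show ?thesis using t by auto
qed

lemma sum_vec_apply: "(\<Sum>a\<in>A. F a) k = (\<Sum>a\<in>A. (F a :: 'k tvec) k)"
  by (induction A rule: infinite_finite_induct) auto

lemma lsum_eq_sum: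
  assumes "finite A'" "A' \<subseteq> A" "\<And>b. b \<in> A \<Longrightarrow> b \<notin> A' \<Longrightarrow> F b = 0"
  shows "lsum A F = (\<Sum>b\<in>A'. F b)"
proof
  fix k
  have "(\<Sum>b\<in>{b \<in> A. F b k \<noteq> 0}. F b k) = (\<Sum>b\<in>A'. F b k)"
    by (rule sum.mono_neutral_left) (use assms in \<open>auto, metis zero_fun_apply\<close>)
  then show "lsum A F k = (\<Sum>b\<in>A'. F b) k" by (simp add: lsum_def sum_vec_apply)
qed

text \<open>
  At an index where infinitely many summands are nonzero, \<open>lsum\<close> takes the default value \<open>0\<close>, so
  linearity of the summands does not pass to the sum in general.  If each generator meets only finitely many summands, so does
  each vector of the span, and on any two given vectors the sum is a finite one.
\<close>

lemma linear_on_lsum: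
  assumes F: "\<And>b. b \<in> A \<Longrightarrow> linear_on (fv.span B) (F b)"
    and fin: "\<And>t. t \<in> B \<Longrightarrow> finite {b \<in> A. F b t \<noteq> 0}"
  shows "linear_on (fv.span B) (\<lambda>t. lsum A (\<lambda>b. F b t))"
proof -
  let ?N = "\<lambda>t. {b \<in> A. F b t \<noteq> 0}"
  have add: "?N (u + v) \<subseteq> ?N u \<union> ?N v" if "u \<in> fv.span B" "v \<in> fv.span B" for u v
    using that by (auto simp: linear_on_add[OF F])
  have scl: "?N (scl c u) \<subseteq> ?N u" if "u \<in> fv.span B" for c u
    using that by (auto simp: linear_on_scl[OF F])
  have "fv.span B \<subseteq> {t \<in> fv.span B. finite (?N t)}"
  proof (rule fv.span_minimal)
    have N0: "finite (?N 0)"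
      using linear_on_0[OF F fv.span_zero] by (metis (mono_tags, lifting) empty_Collect_eq finite.emptyI)
    have Nadd: "finite (?N (u + v))"
      if "u \<in> fv.span B" "v \<in> fv.span B" "finite (?N u)" "finite (?N v)" for u v
      using finite_subset[OF add[OF that(1,2)]] that by blast
    have Nscl: "finite (?N (scl c u))" if "u \<in> fv.span B" "finite (?N u)" for c u
      using finite_subset[OF scl[OF that(1)]] that by blast
    show "fv.subspace {t \<in> fv.span B. finite (?N t)}"
      by (rule fv.subspaceI; clarify)
        (intro conjI N0 Nadd Nscl fv.span_zero fv.span_add fv.span_scale; assumption)+
  qed (use fin in \<open>auto intro: fv.span_base\<close>)
  then have fin': "finite (?N t)" if "t \<in> fv.span B" for t using that by auto
  show ?thesis
  proof (rule linear_onI)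
    fix u v assume uv: "u \<in> fv.span B" "v \<in> fv.span B"
    let ?M = "?N u \<union> ?N v"
    have M: "finite ?M" "?M \<subseteq> A" using fin' uv by auto
    have "lsum A (\<lambda>b. F b (u + v)) = (\<Sum>b\<in>?M. F b (u + v))"
      using add[OF uv] by (intro lsum_eq_sum[OF M]) blast
    also have "\<dots> = (\<Sum>b\<in>?M. F b u) + (\<Sum>b\<in>?M. F b v)"
      unfolding sum.distrib[symmetric] using uv by (intro sum.cong) (auto simp: linear_on_add[OF F])
    also have "(\<Sum>b\<in>?M. F b u) = lsum A (\<lambda>b. F b u)" by (rule lsum_eq_sum[OF M, symmetric]) auto
    also have "(\<Sum>b\<in>?M. F b v) = lsum A (\<lambda>b. F b v)" by (rule lsum_eq_sum[OF M, symmetric]) auto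
    finally show "lsum A (\<lambda>b. F b (u + v)) = lsum A (\<lambda>b. F b u) + lsum A (\<lambda>b. F b v)" .
  next
    fix c u assume u: "u \<in> fv.span B"
    have M: "finite (?N u)" "?N u \<subseteq> A" using fin' u by auto
    have "lsum A (\<lambda>b. F b (scl c u)) = (\<Sum>b\<in>?N u. F b (scl c u))"
      using scl[OF u] by (intro lsum_eq_sum[OF M]) blast
    also have "\<dots> = scl c (\<Sum>b\<in>?N u. F b u)"
      unfolding fv.scale_sum_right using u by (intro sum.cong) (auto simp: linear_on_scl[OF F])
    also have "(\<Sum>b\<in>?N u. F b u) = lsum A (\<lambda>b. F b u)"
      by (rule lsum_eq_sum[OF M, symmetric]) auto
    finally show "lsum A (\<lambda>b. F b (scl c u)) = scl c (lsum A (\<lambda>b. F b u))" .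
  qed
qed

section \<open>Pure tensors and spaces of strings\<close>

lemma tens_add_left: "(u + u') \<otimes>\<^sub>t v = u \<otimes>\<^sub>t v + u' \<otimes>\<^sub>t v"
  by (auto simp: tens_def fun_eq_iff algebra_simps)

lemma tens_add_right: "u \<otimes>\<^sub>t (v + v') = u \<otimes>\<^sub>t v + u \<otimes>\<^sub>t v'"
  by (auto simp: tens_def fun_eq_iff algebra_simps)

lemma tens_scl_left: "scl c u \<otimes>\<^sub>t v = scl c (u \<otimes>\<^sub>t v)"
  by (auto simp: tens_def scl_def fun_eq_iff algebra_simps)

lemma tens_scl_right: "u \<otimes>\<^sub>t scl c v = scl c (u \<otimes>\<^sub>t v)"
  by (auto simp: tens_def scl_def fun_eq_iff algebra_simps)

lemma tens_zero [simp]: "0 \<otimes>\<^sub>t v = 0" "u \<otimes>\<^sub>t 0 = 0"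
  by (auto simp: tens_def fun_eq_iff)

lemma linear_on_tens_left: "linear_on W (\<lambda>u. u \<otimes>\<^sub>t v)"
  by (simp add: linear_on_def tens_add_left tens_scl_left)

lemma linear_on_tens_right: "linear_on W (\<lambda>v. u \<otimes>\<^sub>t v)"
  by (simp add: linear_on_def tens_add_right tens_scl_right)

lemma tens_sum_left: "(\<Sum>a\<in>A. F a) \<otimes>\<^sub>t v = (\<Sum>a\<in>A. F a \<otimes>\<^sub>t v)"
  by (rule linear_on_sum[OF linear_on_tens_left fv.subspace_UNIV]) simp

lemma tens_sum_right: "u \<otimes>\<^sub>t (\<Sum>a\<in>A. F a) = (\<Sum>a\<in>A. u \<otimes>\<^sub>t F a)"
  by (rule linear_on_sum[OF linear_on_tens_right fv.subspace_UNIV]) simp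

lemma in_tot: "u \<in> H x y \<Longrightarrow> u \<in> tot H"
  unfolding tot_def by (rule fv.span_base) blast

lemma subspace_tot: "fv.subspace (tot H)"
  by (simp add: tot_def)

lemma subspace_concat: "fv.subspace ((H \<odot> K) x z)"
  by (simp add: concat_tens_def)

lemma tens_in_concat: "u \<in> H x y \<Longrightarrow> v \<in> K y z \<Longrightarrow> u \<otimes>\<^sub>t v \<in> (H \<odot> K) x z"
  unfolding concat_tens_def by (rule fv.span_base) blast

text \<open>
  Bilinearity: generators of the two factors suffice for the product.  Nested products are reduced by
  it to pure tensors with several factors.
\<close>

lemma concat_tens_span:
  "((\<lambda>x y. fv.span (A x y)) \<odot> (\<lambda>y z. fv.span (B y z))) x z =
    fv.span {a \<otimes>\<^sub>t b | a b. \<exists>y. a \<in> A x y \<and> b \<in> B y z}" (is "?L = fv.span ?G")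
proof
  have *: "a \<otimes>\<^sub>t v \<in> fv.span ?G" if "a \<in> A x y" "v \<in> fv.span (B y z)" for a v y
  proof (rule linear_on_span_image[OF linear_on_tens_right fv.subspace_UNIV _ _ _ that(2)])
    fix b assume "b \<in> B y z"
    then show "a \<otimes>\<^sub>t b \<in> fv.span ?G" using that by (intro fv.span_base) blast
  qed simp_all
  have "u \<otimes>\<^sub>t v \<in> fv.span ?G" if "u \<in> fv.span (A x y)" "v \<in> fv.span (B y z)" for u v y
  proof (rule linear_on_span_image[OF linear_on_tens_left fv.subspace_UNIV _ _ _ that(1)])
    fix a assume "a \<in> A x y"
    then show "a \<otimes>\<^sub>t v \<in> fv.span ?G" using *[OF _ that(2)] by blast
  qed simp_all
  then show "?L \<subseteq> fv.span ?G"
    unfolding concat_tens_def by (intro fv.span_minimal) (blast, simp)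
  have "?G \<subseteq> {u \<otimes>\<^sub>t v | u v. \<exists>y. u \<in> fv.span (A x y) \<and> v \<in> fv.span (B y z)}"
    using fv.span_superset[of "A x _"] fv.span_superset[of "B _ z"] by blast
  then show "fv.span ?G \<subseteq> ?L"
    unfolding concat_tens_def by (rule fv.span_mono)
qed

lemma tot_span: "tot (\<lambda>x y. fv.span (A x y)) = fv.span (\<Union>x y. A x y)"
proof
  have "fv.span (A x y) \<subseteq> fv.span (\<Union>x y. A x y)" for x y by (rule fv.span_mono) blast
  then show "tot (\<lambda>x y. fv.span (A x y)) \<subseteq> fv.span (\<Union>x y. A x y)"
    unfolding tot_def by (intro fv.span_minimal) (blast, simp)
  have "A x y \<subseteq> fv.span (A x y)" for x y by (rule fv.span_superset)
  then show "fv.span (\<Union>x y. A x y) \<subseteq> tot (\<lambda>x y. fv.span (A x y))"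
    unfolding tot_def by (intro fv.span_mono) blast
qed

lemma span_components: "(\<And>x y. fv.subspace (H x y)) \<Longrightarrow> (\<lambda>x y. fv.span (H x y)) = H"
  by (intro ext) (simp only: fv.span_eq_iff)

lemma concat_generators:
  "H \<odot> K = (\<lambda>x z. fv.span {u \<otimes>\<^sub>t v | u v. \<exists>y. u \<in> H x y \<and> v \<in> K y z})"
  by (intro ext) (simp only: concat_tens_def)

lemma tot_concat:
  "tot (H \<odot> K) = fv.span {u \<otimes>\<^sub>t v | u v. \<exists>x y z. u \<in> H x y \<and> v \<in> K y z}"
proof -
  have "{u \<otimes>\<^sub>t v | u v. \<exists>x y z. u \<in> H x y \<and> v \<in> K y z}
     = (\<Union>x z. {u \<otimes>\<^sub>t v | u v. \<exists>y. u \<in> H x y \<and> v \<in> K y z})" by blast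
  then show ?thesis unfolding concat_generators tot_span by simp
qed

lemma concat_image_in_subspace:
  assumes f: "linear_on (tot (H \<odot> K)) f" and X: "fv.subspace X"
    and gen: "\<And>u v y. u \<in> H x y \<Longrightarrow> v \<in> K y z \<Longrightarrow> f (u \<otimes>\<^sub>t v) \<in> X"
    and t: "t \<in> (H \<odot> K) x z"
  shows "f t \<in> X"
proof (rule linear_on_span_image[OF f subspace_tot _ X _ t[unfolded concat_tens_def]])
  show "{u \<otimes>\<^sub>t v |u v. \<exists>y. u \<in> H x y \<and> v \<in> K y z} \<subseteq> tot (H \<odot> K)"
    unfolding tot_concat by (rule subset_trans[OF _ fv.span_superset]) blast
qed (use gen in blast)

text \<open>
  Extensionality on one component of a product of string spaces: two linear maps are compared on
  composable pure tensors.
\<close>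

lemma concat_eqI:
  assumes f: "linear_on ((H \<odot> K) x z) f" and g: "linear_on ((H \<odot> K) x z) g"
    and gen: "\<And>u v y. u \<in> H x y \<Longrightarrow> v \<in> K y z \<Longrightarrow> f (u \<otimes>\<^sub>t v) = g (u \<otimes>\<^sub>t v)"
    and t: "t \<in> (H \<odot> K) x z"
  shows "f t = g t"
proof (rule linear_on_span_eq[OF f g subspace_concat _ _ t[unfolded concat_tens_def]])
  show "{u \<otimes>\<^sub>t v |u v. \<exists>y. u \<in> H x y \<and> v \<in> K y z} \<subseteq> (H \<odot> K) x z"
    unfolding concat_tens_def by (rule fv.span_superset)
qed (use gen in blast)

lemma HomI:
  assumes f: "linear_on (tot H) f" and H: "H = (\<lambda>x y. fv.span (A x y))"
    and im: "\<And>x y a. a \<in> A x y \<Longrightarrow> f a \<in> K x y" and K: "\<And>x y. fv.subspace (K x y)"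
  shows "f \<in> Hom H K"
proof -
  have "f t \<in> K x y" if "t \<in> H x y" for t x y
  proof (rule linear_on_span_image[OF f subspace_tot _ K im])
    show "A x y \<subseteq> tot H" unfolding H tot_span
      by (rule subset_trans[OF _ fv.span_superset]) blast
    show "t \<in> fv.span (A x y)" using that H by simp
  qed
  then show ?thesis using f unfolding Hom_def by auto
qed

lemma Hom_linear: "f \<in> Hom H K \<Longrightarrow> linear_on (tot H) f"
  by (simp add: Hom_def)

lemma Hom_in: "f \<in> Hom H K \<Longrightarrow> u \<in> H x y \<Longrightarrow> f u \<in> K x y"
  by (auto simp: Hom_def)

lemma Hom_tot:
  assumes "f \<in> Hom H K"
  shows "f ` tot H \<subseteq> tot K"
proof -
  have "f t \<in> tot K" if "t \<in> tot H" for t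
  proof (rule linear_on_span_image[OF Hom_linear[OF assms] subspace_tot _ subspace_tot _
        that[unfolded tot_def]])
    show "(\<Union>x y. H x y) \<subseteq> tot H" unfolding tot_def by (rule fv.span_superset)
    fix b assume "b \<in> (\<Union>x y. H x y)"
    then show "f b \<in> tot K" using Hom_in[OF assms] in_tot[of _ K] by blast
  qed
  then show ?thesis by blast
qed

lemma Hom_compose:
  assumes "f \<in> Hom H K" "g \<in> Hom K M"
  shows "(\<lambda>t. g (f t)) \<in> Hom H M"
proof -
  have "g (f t) \<in> M x y" if "t \<in> H x y" for t x y
    using Hom_in[OF assms(2) Hom_in[OF assms(1) that]] .
  then show ?thesis
    using linear_on_compose[OF Hom_linear[OF assms(1)] Hom_linear[OF assms(2)] Hom_tot[OF assms(1)]]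
    unfolding Hom_def by blast
qed

section \<open>Operators on tensor factors\<close>

text \<open>
  A slice of a pure tensor \<open>u \<otimes>\<^sub>t v\<close> is a multiple of \<open>u\<close>, so slices of strings are strings.  This is
  what makes the slicewise action of an operator that is linear on strings only well behaved.
\<close>

lemma slice_left:
  assumes "t \<in> tot (H \<odot> K)"
  shows "(\<lambda>p. t (p, q)) \<in> tot H"
proof (rule linear_on_span_image[where f = "\<lambda>t p. t (p, q)",
      OF _ fv.subspace_UNIV _ subspace_tot _ assms[unfolded tot_concat]])
  show "linear_on UNIV (\<lambda>t p. t (p, q))" by (auto simp: linear_on_def scl_def fun_eq_iff)
  fix b assume "b \<in> {u \<otimes>\<^sub>t v |u v. \<exists>x y z. u \<in> H x y \<and> v \<in> K y z}"
  then obtain u v x y where b: "b = u \<otimes>\<^sub>t v" "u \<in> H x y" by blast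
  then have "(\<lambda>p. b (p, q)) = scl (v q) u" by (auto simp: tens_def scl_def)
  then show "(\<lambda>p. b (p, q)) \<in> tot H" using in_tot[of u H x y] b fv.subspace_scale[OF subspace_tot] by metis
qed simp

lemma slice_right:
  assumes "t \<in> tot (H \<odot> K)"
  shows "(\<lambda>q. t (p, q)) \<in> tot K"
proof (rule linear_on_span_image[where f = "\<lambda>t q. t (p, q)",
      OF _ fv.subspace_UNIV _ subspace_tot _ assms[unfolded tot_concat]])
  show "linear_on UNIV (\<lambda>t q. t (p, q))" by (auto simp: linear_on_def scl_def fun_eq_iff)
  fix b assume "b \<in> {u \<otimes>\<^sub>t v |u v. \<exists>x y z. u \<in> H x y \<and> v \<in> K y z}"
  then obtain u v y z where b: "b = u \<otimes>\<^sub>t v" "v \<in> K y z" by blast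
  then have "(\<lambda>q. b (p, q)) = scl (u p) v" by (auto simp: tens_def scl_def)
  then show "(\<lambda>q. b (p, q)) \<in> tot K" using in_tot[of v K y z] b fv.subspace_scale[OF subspace_tot] by metis
qed simp

lemma linear_on_act_left:
  assumes f: "linear_on U f" and sl: "\<And>t q. t \<in> W \<Longrightarrow> (\<lambda>p. t (p, q)) \<in> U"
  shows "linear_on W (act_left f)"
proof (rule linear_onI)
  fix u v assume "u \<in> W" "v \<in> W"
  then have "f (\<lambda>p. (u + v) (p, q)) = f (\<lambda>p. u (p, q)) + f (\<lambda>p. v (p, q))" for q
    using linear_on_add[OF f sl sl] by (simp add: plus_fun_def)
  then show "act_left f (u + v) = act_left f u + act_left f v"
    by (auto simp: act_left_def fun_eq_iff)
next
  fix c u assume "u \<in> W"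
  then have "f (\<lambda>p. scl c u (p, q)) = scl c (f (\<lambda>p. u (p, q)))" for q
    using linear_on_scl[OF f sl] by (simp add: scl_def)
  then show "act_left f (scl c u) = scl c (act_left f u)"
    by (auto simp: act_left_def fun_eq_iff scl_def)
qed

lemma linear_on_act_right:
  assumes f: "linear_on U f" and sl: "\<And>t p. t \<in> W \<Longrightarrow> (\<lambda>q. t (p, q)) \<in> U"
  shows "linear_on W (act_right f)"
proof (rule linear_onI)
  fix u v assume "u \<in> W" "v \<in> W"
  then have "f (\<lambda>q. (u + v) (p, q)) = f (\<lambda>q. u (p, q)) + f (\<lambda>q. v (p, q))" for p
    using linear_on_add[OF f sl sl] by (simp add: plus_fun_def)
  then show "act_right f (u + v) = act_right f u + act_right f v"
    by (auto simp: act_right_def fun_eq_iff)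
next
  fix c u assume "u \<in> W"
  then have "f (\<lambda>q. scl c u (p, q)) = scl c (f (\<lambda>q. u (p, q)))" for p
    using linear_on_scl[OF f sl] by (simp add: scl_def)
  then show "act_right f (scl c u) = scl c (act_right f u)"
    by (auto simp: act_right_def fun_eq_iff scl_def)
qed

lemma act_left_tens:
  assumes "linear_on U f" "u \<in> U"
  shows "act_left f (u \<otimes>\<^sub>t v) = f u \<otimes>\<^sub>t v"
proof -
  have "f (\<lambda>p. (u \<otimes>\<^sub>t v) (p, q)) = scl (v q) (f u)" for q
    using linear_on_scl[OF assms, of "v q"] by (simp add: tens_def scl_def mult.commute)
  then show ?thesis by (auto simp: act_left_def tens_def scl_def fun_eq_iff)
qed

lemma act_right_tens:
  assumes "linear_on U f" "v \<in> U"
  shows "act_right f (u \<otimes>\<^sub>t v) = u \<otimes>\<^sub>t f v"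
proof -
  have "f (\<lambda>q. (u \<otimes>\<^sub>t v) (p, q)) = scl (u p) (f v)" for p
    using linear_on_scl[OF assms, of "u p"] by (simp add: tens_def scl_def)
  then show ?thesis by (auto simp: act_right_def tens_def scl_def fun_eq_iff)
qed

lemma map_tens_tens:
  assumes "linear_on U f" "u \<in> U" "linear_on W g" "v \<in> W"
  shows "map_tens f g (u \<otimes>\<^sub>t v) = f u \<otimes>\<^sub>t g v"
  by (simp add: map_tens_def act_right_tens[OF assms(3,4)] act_left_tens[OF assms(1,2)])

text \<open>
  The second operator is applied to slices of the result of the first; the set \<open>?X\<close> of tensors whose
  slices are strings records that these slices still lie where the second operator is linear.
\<close>

lemma linear_on_map_tens:
  assumes f: "linear_on (tot H) f" and g: "linear_on (tot K) g"
  shows "linear_on (tot (H \<odot> K)) (map_tens f g)"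
proof -
  have g': "linear_on (tot (H \<odot> K)) (act_right g)"
    by (rule linear_on_act_right[OF g slice_right])
  let ?X = "{s. \<forall>q. (\<lambda>p. s (p, q)) \<in> tot H}"
  have X: "fv.subspace ?X"
    using subspace_tot[of H] unfolding subspace_scl by (auto simp: scl_def plus_fun_def zero_fun_def)
  have "act_right g t \<in> ?X" if "t \<in> tot (H \<odot> K)" for t
  proof (rule linear_on_span_image[OF g' subspace_tot _ X _ that[unfolded tot_concat]])
    fix b assume "b \<in> {u \<otimes>\<^sub>t v |u v. \<exists>x y z. u \<in> H x y \<and> v \<in> K y z}"
    then obtain u v x y z where b: "b = u \<otimes>\<^sub>t v" "u \<in> H x y" "v \<in> K y z" by blast
    have eq: "act_right g b = u \<otimes>\<^sub>t g v"
      unfolding b(1) by (rule act_right_tens[where U = "tot K", OF g in_tot[where H = K, OF b(3)]])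
    have "(\<lambda>p. (u \<otimes>\<^sub>t g v) (p, q)) = scl (g v q) u" for q by (auto simp: tens_def scl_def)
    then show "act_right g b \<in> ?X"
      unfolding eq using fv.subspace_scale[OF subspace_tot in_tot[where H = H, OF b(2)]] by auto
  qed (simp_all only: tot_concat fv.span_superset)
  then have im: "act_right g ` tot (H \<odot> K) \<subseteq> ?X" by blast
  have "linear_on ?X (act_left f)" by (rule linear_on_act_left[OF f]) blast
  then have "linear_on (tot (H \<odot> K)) (\<lambda>t. act_left f (act_right g t))"
    by (rule linear_on_compose[OF g' _ im])
  then show ?thesis by (simp add: map_tens_def[abs_def])
qed

lemma act23_Hom:
  assumes "f \<in> Hom K K'"
  shows "act23 f \<in> Hom (H \<odot> K) (H \<odot> K')"
proof (rule HomI[OF _ concat_generators _ subspace_concat])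
  show "linear_on (tot (H \<odot> K)) (act23 f)"
    unfolding act23_def by (rule linear_on_act_right[OF Hom_linear[OF assms] slice_right])
  fix x z b assume "b \<in> {u \<otimes>\<^sub>t v |u v. \<exists>y. u \<in> H x y \<and> v \<in> K y z}"
  then obtain u v y where b: "b = u \<otimes>\<^sub>t v" "u \<in> H x y" "v \<in> K y z" by blast
  have "act23 f b = u \<otimes>\<^sub>t f v"
    unfolding b(1) act23_def
    by (rule act_right_tens[where U = "tot K", OF Hom_linear[OF assms] in_tot[where H = K, OF b(3)]])
  then show "act23 f b \<in> (H \<odot> K') x z"
    using tens_in_concat[where H = H and K = K', OF b(2) Hom_in[OF assms b(3)]] by (simp only:)
qed

text \<open>
  The operator \<open>act12 f\<close> is \<open>act_left f\<close> up to reassociation, because iterated tensor products are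
  nested to the right.
\<close>

definition assoc_right :: "(('k \<times> 'l) \<times> 'm) tvec \<Rightarrow> ('k \<times> 'l \<times> 'm) tvec" where
  "assoc_right t = (\<lambda>(p, q, r). t ((p, q), r))"

lemma assoc_right_tens: "assoc_right ((u \<otimes>\<^sub>t v) \<otimes>\<^sub>t w) = u \<otimes>\<^sub>t v \<otimes>\<^sub>t w"
  by (auto simp: assoc_right_def tens_def fun_eq_iff)

lemma linear_on_assoc_right: "linear_on W assoc_right"
  by (auto simp: assoc_right_def linear_on_def scl_def fun_eq_iff)

lemma concat3_generators:
  assumes "\<And>x y. fv.subspace (H x y)"
  shows "H \<odot> K \<odot> M = (\<lambda>x z.
    fv.span {u \<otimes>\<^sub>t s | u s. \<exists>y. u \<in> H x y \<and> s \<in> {v \<otimes>\<^sub>t w | v w. \<exists>y'. v \<in> K y y' \<and> w \<in> M y' z}})"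
  unfolding concat_generators[of K M]
  by (intro ext) (rule concat_tens_span[where A = H, unfolded span_components[of H, OF assms]])

lemma assoc_right_concat:
  assumes T: "T \<in> (H \<odot> K) x y" and w: "w \<in> M y z"
  shows "assoc_right (T \<otimes>\<^sub>t w) \<in> (H \<odot> K \<odot> M) x z"
proof (rule linear_on_span_image[where f = "\<lambda>T. assoc_right (T \<otimes>\<^sub>t w)",
      OF _ fv.subspace_UNIV _ subspace_concat _ T[unfolded concat_tens_def]])
  show "linear_on UNIV (\<lambda>T. assoc_right (T \<otimes>\<^sub>t w))"
    by (rule linear_on_compose[OF linear_on_tens_left linear_on_assoc_right subset_UNIV])
  fix b assume "b \<in> {u \<otimes>\<^sub>t v |u v. \<exists>ya. u \<in> H x ya \<and> v \<in> K ya y}"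
  then obtain u v y' where b: "b = u \<otimes>\<^sub>t v" "u \<in> H x y'" "v \<in> K y' y" by blast
  show "assoc_right (b \<otimes>\<^sub>t w) \<in> (H \<odot> K \<odot> M) x z"
    unfolding b(1) assoc_right_tens
    by (rule tens_in_concat[where H = H and K = "K \<odot> M", OF b(2)
          tens_in_concat[where H = K and K = M, OF b(3) w]])
qed simp_all

lemma act12_assoc_right:
  "act12 f t = assoc_right (act_left f (\<lambda>((p, q), r). t (p, q, r)))"
  by (auto simp: act12_def assoc_right_def act_left_def fun_eq_iff case_prod_beta')

lemma act12_tens:
  assumes "linear_on U f" "T \<in> U"
  shows "act12 f (assoc_right (T \<otimes>\<^sub>t w)) = assoc_right (f T \<otimes>\<^sub>t w)"
proof -
  have "(\<lambda>((p, q), r). assoc_right (T \<otimes>\<^sub>t w) (p, q, r)) = T \<otimes>\<^sub>t w"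
    by (auto simp: assoc_right_def)
  then show ?thesis by (simp add: act12_assoc_right act_left_tens[OF assms])
qed

text \<open>
  As for \<open>act_left\<close>, after regrouping the three factors: the slices along the third factor of a
  string of three are strings of the first two.
\<close>

lemma act12_Hom:
  assumes f: "f \<in> Hom (H \<odot> K) (H' \<odot> K')" and H: "\<And>x y. fv.subspace (H x y)"
  shows "act12 f \<in> Hom (H \<odot> K \<odot> M) (H' \<odot> K' \<odot> M)"
proof -
  let ?A = "\<lambda>x z. {u \<otimes>\<^sub>t s | u s. \<exists>y. u \<in> H x y \<and>
    s \<in> {v \<otimes>\<^sub>t w | v w. \<exists>y'. v \<in> K y y' \<and> w \<in> M y' z}}"
  let ?r = "\<lambda>t. (\<lambda>((p, q), r). t (p, q, r))"
  have "linear_on (tot (H \<odot> K \<odot> M)) (act12 f)"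
    unfolding act12_assoc_right
  proof (rule linear_on_compose[OF linear_on_compose[where g = ?r] linear_on_assoc_right])
    let ?X = "{t. \<forall>r. (\<lambda>p. t (p, r)) \<in> tot (H \<odot> K)}"
    show r: "linear_on (tot (H \<odot> K \<odot> M)) ?r"
      by (auto simp: linear_on_def scl_def fun_eq_iff)
    show "linear_on ?X (act_left f)"
      by (rule linear_on_act_left[OF Hom_linear[OF f]]) auto
    have X: "fv.subspace ?X"
      using subspace_tot[of "H \<odot> K"] unfolding subspace_scl
      by (auto simp: scl_def plus_fun_def zero_fun_def)
    have "?r t \<in> ?X" if "t \<in> tot (H \<odot> K \<odot> M)" for t
    proof (rule linear_on_span_image[OF r subspace_tot _ X _ that[unfolded concat3_generators[OF H] tot_span]])
      show "(\<Union>x z. ?A x z) \<subseteq> tot (H \<odot> K \<odot> M)"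
        unfolding concat3_generators[OF H] tot_span by (rule fv.span_superset)
      fix b assume "b \<in> (\<Union>x z. ?A x z)"
      then obtain u v w x y z where b: "b = u \<otimes>\<^sub>t v \<otimes>\<^sub>t w" "u \<in> H x y" "v \<in> K y z" by blast
      have "(\<lambda>p. ?r b (p, r)) = scl (w r) (u \<otimes>\<^sub>t v)" for r
        by (auto simp: b tens_def scl_def)
      then show "?r b \<in> ?X"
        using fv.subspace_scale[OF subspace_tot in_tot[where H = "H \<odot> K",
            OF tens_in_concat[where H = H and K = K, OF b(2,3)]]] by auto
    qed
    then show "?r ` tot (H \<odot> K \<odot> M) \<subseteq> ?X" by blast
  qed auto
  then show ?thesis
  proof (rule HomI[OF _ concat3_generators[OF H] _ subspace_concat])
    fix x z b assume "b \<in> ?A x z"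
    then obtain u v w y y' where b: "b = u \<otimes>\<^sub>t v \<otimes>\<^sub>t w" "u \<in> H x y" "v \<in> K y y'" "w \<in> M y' z" by blast
    have uv: "u \<otimes>\<^sub>t v \<in> (H \<odot> K) x y'" by (rule tens_in_concat[where H = H and K = K, OF b(2,3)])
    have "act12 f b = assoc_right (f (u \<otimes>\<^sub>t v) \<otimes>\<^sub>t w)"
      using act12_tens[OF Hom_linear[OF f] in_tot[where H = "H \<odot> K", OF uv]]
      by (simp only: b(1) assoc_right_tens)
    then show "act12 f b \<in> (H' \<odot> K' \<odot> M) x z"
      using assoc_right_concat[where H = H' and K = K' and M = M, OF Hom_in[OF f uv] b(4)]
      by (simp only:)
  qed
qed

section \<open>Fusion of families of maps\<close>

text \<open>
  Finiteness is postulated over objects, but the fibres over anything else are empty.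
\<close>

lemma cell_fibres_finite:
  assumes "cell_set G1 G2 \<Xi>"
  shows "finite {\<beta> \<in> Cells \<Xi>. csrc \<Xi> \<beta> = x}" and "finite {\<beta> \<in> Cells \<Xi>. ctgt \<Xi> \<beta> = c}"
proof -
  have "{\<beta> \<in> Cells \<Xi>. csrc \<Xi> \<beta> = x} = {}" if "x \<notin> Ob G1"
    using assms that unfolding cell_set_def by blast
  then show "finite {\<beta> \<in> Cells \<Xi>. csrc \<Xi> \<beta> = x}"
    using assms unfolding cell_set_def by (metis finite.emptyI)
  have "{\<beta> \<in> Cells \<Xi>. ctgt \<Xi> \<beta> = c} = {}" if "c \<notin> Ob G2"
    using assms that unfolding cell_set_def by blast
  then show "finite {\<beta> \<in> Cells \<Xi>. ctgt \<Xi> \<beta> = c}"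
    using assms unfolding cell_set_def by (metis finite.emptyI)
qed

lemma Fam_linear:
  "f \<in> Fam \<Xi> H K \<Longrightarrow> \<beta>1 \<in> Cells \<Xi> \<Longrightarrow> \<beta>2 \<in> Cells \<Xi> \<Longrightarrow> linear_on (tot H) (f \<beta>1 \<beta>2)"
  by (simp add: Fam_def block_Hom_def)

lemma Fam_in:
  assumes "f \<in> Fam \<Xi> H K" "\<beta>1 \<in> Cells \<Xi>" "\<beta>2 \<in> Cells \<Xi>" "u \<in> H (csrc \<Xi> \<beta>2) (csrc \<Xi> \<beta>1)"
  shows "f \<beta>1 \<beta>2 u \<in> K (ctgt \<Xi> \<beta>2) (ctgt \<Xi> \<beta>1)"
proof -
  have "f \<beta>1 \<beta>2 ` H (csrc \<Xi> \<beta>2) (csrc \<Xi> \<beta>1) \<subseteq> K (ctgt \<Xi> \<beta>2) (ctgt \<Xi> \<beta>1)"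
    using assms(1-3) by (simp add: Fam_def block_Hom_def)
  then show ?thesis using assms(4) by blast
qed

lemma Fam_zero:
  assumes "f \<in> Fam \<Xi> H K" "\<beta>1 \<in> Cells \<Xi>" "\<beta>2 \<in> Cells \<Xi>" "u \<in> H x y"
    and "x \<noteq> csrc \<Xi> \<beta>2 \<or> y \<noteq> csrc \<Xi> \<beta>1"
  shows "f \<beta>1 \<beta>2 u = 0"
proof -
  have "\<forall>v w. (v, w) \<noteq> (csrc \<Xi> \<beta>2, csrc \<Xi> \<beta>1) \<longrightarrow> (\<forall>u \<in> H v w. f \<beta>1 \<beta>2 u = 0)"
    using assms(1-3) by (simp add: Fam_def block_Hom_def)
  then show ?thesis using assms(4,5) by blast
qed

lemma FamI:
  assumes lin: "\<And>\<beta>1 \<beta>2. \<beta>1 \<in> Cells \<Xi> \<Longrightarrow> \<beta>2 \<in> Cells \<Xi> \<Longrightarrow> linear_on (tot H) (f \<beta>1 \<beta>2)"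
    and block: "\<And>\<beta>1 \<beta>2 u. \<beta>1 \<in> Cells \<Xi> \<Longrightarrow> \<beta>2 \<in> Cells \<Xi> \<Longrightarrow> u \<in> H (csrc \<Xi> \<beta>2) (csrc \<Xi> \<beta>1) \<Longrightarrow>
      f \<beta>1 \<beta>2 u \<in> K (ctgt \<Xi> \<beta>2) (ctgt \<Xi> \<beta>1)"
    and zero: "\<And>\<beta>1 \<beta>2 u x y. \<beta>1 \<in> Cells \<Xi> \<Longrightarrow> \<beta>2 \<in> Cells \<Xi> \<Longrightarrow> u \<in> H x y \<Longrightarrow>
      x \<noteq> csrc \<Xi> \<beta>2 \<or> y \<noteq> csrc \<Xi> \<beta>1 \<Longrightarrow> f \<beta>1 \<beta>2 u = 0"
  shows "f \<in> Fam \<Xi> H K"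
  unfolding Fam_def block_Hom_def
proof (intro CollectI ballI conjI allI impI)
  fix \<beta>1 \<beta>2 assume b: "\<beta>1 \<in> Cells \<Xi>" "\<beta>2 \<in> Cells \<Xi>"
  show "linear_on (tot H) (f \<beta>1 \<beta>2)" using lin b .
  show "f \<beta>1 \<beta>2 ` H (csrc \<Xi> \<beta>2) (csrc \<Xi> \<beta>1) \<subseteq> K (ctgt \<Xi> \<beta>2) (ctgt \<Xi> \<beta>1)"
    using block[OF b] by blast
  fix x y u assume "(x, y) \<noteq> (csrc \<Xi> \<beta>2, csrc \<Xi> \<beta>1)" "u \<in> H x y"
  then show "f \<beta>1 \<beta>2 u = 0" using zero[OF b] by blast
qed

lemma fusion_summand:
  assumes f: "f \<in> Fam \<Xi> H H'" and f': "f' \<in> Fam \<Xi> K K'"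
    and b: "\<beta>1 \<in> Cells \<Xi>" "\<beta>2 \<in> Cells \<Xi>" "\<beta> \<in> Cells \<Xi>"
    and u: "u \<in> H x y" and v: "v \<in> K y' z"
  shows "map_tens (f \<beta> \<beta>2) (f' \<beta>1 \<beta>) (u \<otimes>\<^sub>t v) = f \<beta> \<beta>2 u \<otimes>\<^sub>t f' \<beta>1 \<beta> v"
  by (rule map_tens_tens[where U = "tot H" and W = "tot K",
        OF Fam_linear[OF f b(3,2)] in_tot[where H = H, OF u]
          Fam_linear[OF f' b(1,3)] in_tot[where H = K, OF v]])

text \<open>
  Only the cells over the middle vertex \<open>y\<close> contribute, which makes the sum in a fusion finite on each
  string.
\<close>

lemma fusion_tens:
  assumes f: "f \<in> Fam \<Xi> H H'" and f': "f' \<in> Fam \<Xi> K K'"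
    and fin: "finite {\<beta> \<in> Cells \<Xi>. csrc \<Xi> \<beta> = y}"
    and b: "\<beta>1 \<in> Cells \<Xi>" "\<beta>2 \<in> Cells \<Xi>" and u: "u \<in> H x y" and v: "v \<in> K y' z"
  shows "fusion \<Xi> f f' \<beta>1 \<beta>2 (u \<otimes>\<^sub>t v) =
    (\<Sum>\<beta>\<in>{\<beta> \<in> Cells \<Xi>. csrc \<Xi> \<beta> = y}. f \<beta> \<beta>2 u \<otimes>\<^sub>t f' \<beta>1 \<beta> v)"
proof -
  note summand = fusion_summand[where H = H and K = K, OF f f' b _ u v]
  have "fusion \<Xi> f f' \<beta>1 \<beta>2 (u \<otimes>\<^sub>t v) = (\<Sum>\<beta>\<in>{\<beta> \<in> Cells \<Xi>. csrc \<Xi> \<beta> = y}.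
      map_tens (f \<beta> \<beta>2) (f' \<beta>1 \<beta>) (u \<otimes>\<^sub>t v))"
    unfolding fusion_def
  proof (rule lsum_eq_sum[OF fin])
    fix \<beta> assume \<beta>: "\<beta> \<in> Cells \<Xi>" "\<beta> \<notin> {\<beta> \<in> Cells \<Xi>. csrc \<Xi> \<beta> = y}"
    then have "f \<beta> \<beta>2 u = 0"
      using Fam_zero[where H = H, OF f \<beta>(1) b(2) u] by blast
    then show "map_tens (f \<beta> \<beta>2) (f' \<beta>1 \<beta>) (u \<otimes>\<^sub>t v) = 0"
      by (simp only: summand[OF \<beta>(1)] tens_zero)
  qed blast
  also have "\<dots> = (\<Sum>\<beta>\<in>{\<beta> \<in> Cells \<Xi>. csrc \<Xi> \<beta> = y}. f \<beta> \<beta>2 u \<otimes>\<^sub>t f' \<beta>1 \<beta> v)"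
    by (rule sum.cong[OF refl], rule summand) blast
  finally show ?thesis .
qed

lemma linear_on_fusion:
  assumes f: "f \<in> Fam \<Xi> H H'" and f': "f' \<in> Fam \<Xi> K K'"
    and fin: "\<And>y. finite {\<beta> \<in> Cells \<Xi>. csrc \<Xi> \<beta> = y}"
    and b: "\<beta>1 \<in> Cells \<Xi>" "\<beta>2 \<in> Cells \<Xi>"
  shows "linear_on (tot (H \<odot> K)) (fusion \<Xi> f f' \<beta>1 \<beta>2)"
  unfolding tot_concat fusion_def[abs_def]
proof (rule linear_on_lsum)
  fix \<beta> assume "\<beta> \<in> Cells \<Xi>"
  then show "linear_on (fv.span {u \<otimes>\<^sub>t v |u v. \<exists>x y z. u \<in> H x y \<and> v \<in> K y z})
      (map_tens (f \<beta> \<beta>2) (f' \<beta>1 \<beta>))"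
    using linear_on_map_tens[OF Fam_linear[OF f _ b(2)] Fam_linear[OF f' b(1)]]
    unfolding tot_concat by blast
next
  fix t assume "t \<in> {u \<otimes>\<^sub>t v |u v. \<exists>x y z. u \<in> H x y \<and> v \<in> K y z}"
  then obtain u v x y z where t: "t = u \<otimes>\<^sub>t v" "u \<in> H x y" "v \<in> K y z" by blast
  have "map_tens (f \<beta> \<beta>2) (f' \<beta>1 \<beta>) t = 0" if "\<beta> \<in> Cells \<Xi>" "csrc \<Xi> \<beta> \<noteq> y" for \<beta>
  proof -
    have "f \<beta> \<beta>2 u = 0" using Fam_zero[where H = H, OF f that(1) b(2) t(2)] that(2) by blast
    then show ?thesis
      unfolding t(1)
      by (simp only: fusion_summand[where H = H and K = K, OF f f' b that(1) t(2,3)] tens_zero)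
  qed
  then have "{\<beta> \<in> Cells \<Xi>. map_tens (f \<beta> \<beta>2) (f' \<beta>1 \<beta>) t \<noteq> 0}
      \<subseteq> {\<beta> \<in> Cells \<Xi>. csrc \<Xi> \<beta> = y}" by blast
  then show "finite {\<beta> \<in> Cells \<Xi>. map_tens (f \<beta> \<beta>2) (f' \<beta>1 \<beta>) t \<noteq> 0}"
    by (rule finite_subset[OF _ fin])
qed

text \<open>
  A pure tensor through the vertex \<open>y\<close> is sent by the summand of a cell \<open>\<beta>\<close> over \<open>y\<close> to a pure tensor
  through the target of \<open>\<beta>\<close>, so the summands are composable although each passes through its own
  vertex.
\<close>

lemma fusion_Fam:
  assumes f: "f \<in> Fam \<Xi> H H'" and f': "f' \<in> Fam \<Xi> K K'"
    and fin: "\<And>y. finite {\<beta> \<in> Cells \<Xi>. csrc \<Xi> \<beta> = y}"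
  shows "fusion \<Xi> f f' \<in> Fam \<Xi> (H \<odot> K) (H' \<odot> K')"
proof (rule FamI)
  show lin: "linear_on (tot (H \<odot> K)) (fusion \<Xi> f f' \<beta>1 \<beta>2)"
    if "\<beta>1 \<in> Cells \<Xi>" "\<beta>2 \<in> Cells \<Xi>" for \<beta>1 \<beta>2
    by (rule linear_on_fusion[OF f f' fin that])
  note tens = fusion_tens[where H = H and K = K, OF f f' fin]
  show "fusion \<Xi> f f' \<beta>1 \<beta>2 t \<in> (H' \<odot> K') (ctgt \<Xi> \<beta>2) (ctgt \<Xi> \<beta>1)"
    if b: "\<beta>1 \<in> Cells \<Xi>" "\<beta>2 \<in> Cells \<Xi>" and t: "t \<in> (H \<odot> K) (csrc \<Xi> \<beta>2) (csrc \<Xi> \<beta>1)"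
    for \<beta>1 \<beta>2 t
  proof (rule concat_image_in_subspace[OF lin[OF b] subspace_concat _ t])
    fix u v y assume uv: "u \<in> H (csrc \<Xi> \<beta>2) y" "v \<in> K y (csrc \<Xi> \<beta>1)"
    have "f \<beta> \<beta>2 u \<otimes>\<^sub>t f' \<beta>1 \<beta> v \<in> (H' \<odot> K') (ctgt \<Xi> \<beta>2) (ctgt \<Xi> \<beta>1)"
      if "\<beta> \<in> {\<beta> \<in> Cells \<Xi>. csrc \<Xi> \<beta> = y}" for \<beta>
    proof (rule tens_in_concat[where H = H' and K = K' and y = "ctgt \<Xi> \<beta>"])
      have \<beta>: "\<beta> \<in> Cells \<Xi>" "csrc \<Xi> \<beta> = y" using that by blast+
      show "f \<beta> \<beta>2 u \<in> H' (ctgt \<Xi> \<beta>2) (ctgt \<Xi> \<beta>)"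
        by (rule Fam_in[OF f \<beta>(1) b(2)]) (simp only: \<beta> uv)
      show "f' \<beta>1 \<beta> v \<in> K' (ctgt \<Xi> \<beta>) (ctgt \<Xi> \<beta>1)"
        by (rule Fam_in[OF f' b(1) \<beta>(1)]) (simp only: \<beta> uv)
    qed
    then show "fusion \<Xi> f f' \<beta>1 \<beta>2 (u \<otimes>\<^sub>t v) \<in> (H' \<odot> K') (ctgt \<Xi> \<beta>2) (ctgt \<Xi> \<beta>1)"
      unfolding tens[OF b uv] by (rule fv.subspace_sum[OF subspace_concat])
  qed
  show "fusion \<Xi> f f' \<beta>1 \<beta>2 t = 0"
    if b: "\<beta>1 \<in> Cells \<Xi>" "\<beta>2 \<in> Cells \<Xi>" and t: "t \<in> (H \<odot> K) x z"
      and ne: "x \<noteq> csrc \<Xi> \<beta>2 \<or> z \<noteq> csrc \<Xi> \<beta>1" for \<beta>1 \<beta>2 t x z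
  proof -
    have "fusion \<Xi> f f' \<beta>1 \<beta>2 t \<in> {0}"
    proof (rule concat_image_in_subspace[OF lin[OF b] _ _ t])
      fix u v y assume uv: "u \<in> H x y" "v \<in> K y z"
      have "f \<beta> \<beta>2 u \<otimes>\<^sub>t f' \<beta>1 \<beta> v = 0" if "\<beta> \<in> Cells \<Xi>" for \<beta>
      proof (cases "x = csrc \<Xi> \<beta>2")
        case True
        then have "f' \<beta>1 \<beta> v = 0"
          using ne by (intro Fam_zero[where H = K, OF f' b(1) that uv(2)]) blast
        then show ?thesis by (simp only: tens_zero)
      next
        case False
        then have "f \<beta> \<beta>2 u = 0" by (intro Fam_zero[where H = H, OF f that b(2) uv(1)]) blast
        then show ?thesis by (simp only: tens_zero)
      qed
      then show "fusion \<Xi> f f' \<beta>1 \<beta>2 (u \<otimes>\<^sub>t v) \<in> {0}"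
        unfolding tens[OF b uv] by (intro singletonI[THEN back_subst[of "\<lambda>x. x \<in> {0}"]])
          (rule sum.neutral[symmetric], blast)
    qed (rule fv.subspace_single_0)
    then show ?thesis by blast
  qed
qed

text \<open>
  Exchanging sources and targets, and the two arguments of a family, exchanges the two kinds of
  families and the two kinds of fusion.  Hence every result on \<open>fusion_op\<close> is one on \<open>fusion\<close>.
\<close>

definition dual_cells :: "('p, 'o, 'q) cells \<Rightarrow> ('p, 'q, 'o) cells" where
  "dual_cells \<Xi> = \<lparr>Cells = Cells \<Xi>, csrc = ctgt \<Xi>, ctgt = csrc \<Xi>\<rparr>"

lemma dual_cells_simps [simp]:
  "Cells (dual_cells \<Xi>) = Cells \<Xi>"
  "csrc (dual_cells \<Xi>) = ctgt \<Xi>" "ctgt (dual_cells \<Xi>) = csrc \<Xi>"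
  by (simp_all add: dual_cells_def)

lemma Fam_op_dual: "g \<in> Fam_op \<Xi> H K \<longleftrightarrow> (\<lambda>\<beta>1 \<beta>2. g \<beta>2 \<beta>1) \<in> Fam (dual_cells \<Xi>) K H"
  by (auto simp: Fam_op_def Fam_def)

lemma fusion_op_dual:
  "fusion_op \<Xi> g g' \<beta>1 \<beta>2 = fusion (dual_cells \<Xi>) (\<lambda>\<beta>1 \<beta>2. g \<beta>2 \<beta>1) (\<lambda>\<beta>1 \<beta>2. g' \<beta>2 \<beta>1) \<beta>2 \<beta>1"
  by (simp add: fun_eq_iff fusion_op_def fusion_def)

lemma fusion_op_tens:
  assumes "g \<in> Fam_op \<Xi> H H'" and "g' \<in> Fam_op \<Xi> K K'"
    and "finite {\<beta> \<in> Cells \<Xi>. ctgt \<Xi> \<beta> = c}"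
    and "\<beta>1 \<in> Cells \<Xi>" "\<beta>2 \<in> Cells \<Xi>" and "u \<in> H' a c" and "v \<in> K' c' d"
  shows "fusion_op \<Xi> g g' \<beta>1 \<beta>2 (u \<otimes>\<^sub>t v) =
    (\<Sum>\<beta>\<in>{\<beta> \<in> Cells \<Xi>. ctgt \<Xi> \<beta> = c}. g \<beta>1 \<beta> u \<otimes>\<^sub>t g' \<beta> \<beta>2 v)"
  using fusion_tens[OF assms(1,2)[unfolded Fam_op_dual], of c \<beta>2 \<beta>1 u a v c' d] assms(3-)
  unfolding fusion_op_dual dual_cells_simps by blast

lemma fusion_op_Fam_op:
  assumes "g \<in> Fam_op \<Xi> H H'" and "g' \<in> Fam_op \<Xi> K K'"
    and "\<And>c. finite {\<beta> \<in> Cells \<Xi>. ctgt \<Xi> \<beta> = c}"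
  shows "fusion_op \<Xi> g g' \<in> Fam_op \<Xi> (H \<odot> K) (H' \<odot> K')"
  unfolding Fam_op_dual fusion_op_dual
  using fusion_Fam[OF assms(1,2)[unfolded Fam_op_dual]] assms(3) by simp

lemma Fam_op_linear:
  "g \<in> Fam_op \<Xi> H K \<Longrightarrow> \<beta>1 \<in> Cells \<Xi> \<Longrightarrow> \<beta>2 \<in> Cells \<Xi> \<Longrightarrow> linear_on (tot K) (g \<beta>1 \<beta>2)"
  using Fam_linear[of "\<lambda>\<beta>1 \<beta>2. g \<beta>2 \<beta>1" "dual_cells \<Xi>" K H \<beta>2 \<beta>1] by (simp add: Fam_op_dual)

lemma Fam_op_in:
  "g \<in> Fam_op \<Xi> H K \<Longrightarrow> \<beta>1 \<in> Cells \<Xi> \<Longrightarrow> \<beta>2 \<in> Cells \<Xi> \<Longrightarrow> u \<in> K (ctgt \<Xi> \<beta>1) (ctgt \<Xi> \<beta>2) \<Longrightarrow>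
    g \<beta>1 \<beta>2 u \<in> H (csrc \<Xi> \<beta>1) (csrc \<Xi> \<beta>2)"
  using Fam_in[of "\<lambda>\<beta>1 \<beta>2. g \<beta>2 \<beta>1" "dual_cells \<Xi>" K H \<beta>2 \<beta>1 u] by (simp add: Fam_op_dual)

lemma Fam_op_zero:
  "g \<in> Fam_op \<Xi> H K \<Longrightarrow> \<beta>1 \<in> Cells \<Xi> \<Longrightarrow> \<beta>2 \<in> Cells \<Xi> \<Longrightarrow> u \<in> K c d \<Longrightarrow>
    c \<noteq> ctgt \<Xi> \<beta>1 \<or> d \<noteq> ctgt \<Xi> \<beta>2 \<Longrightarrow> g \<beta>1 \<beta>2 u = 0"
  using Fam_zero[of "\<lambda>\<beta>1 \<beta>2. g \<beta>2 \<beta>1" "dual_cells \<Xi>" K H \<beta>2 \<beta>1 u c d] by (simp add: Fam_op_dual)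


section \<open>Inverting a fusion\<close>

text \<open>
  On \<open>u \<otimes>\<^sub>t v\<close> through the vertex \<open>y\<close> the left-hand side is the sum over \<open>\<beta>\<close>, \<open>\<gamma>\<close>, \<open>\<gamma>'\<close> of
  \<open>g \<beta> \<gamma>' (f \<gamma> \<beta> u) \<otimes>\<^sub>t g' \<gamma>' \<beta>2 (f' \<beta>1 \<gamma> v)\<close>.  Since \<open>g\<close> is graded, only pairs with equal targets of \<open>\<gamma>\<close>
  and \<open>\<gamma>'\<close> occur; these are the pairs for which the inversion rule for \<open>f\<close> applies, so the sum over
  \<open>\<beta>\<close> leaves \<open>\<gamma> = \<gamma>'\<close>.  Then the rule for \<open>f'\<close> removes the sum over \<open>\<gamma>\<close>.
\<close>

lemma fusion_left_inverse:
  assumes f: "f \<in> Fam \<Xi> H H'" and fg: "is_inverse G1 G2 \<Xi> H H' f g"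
    and f': "f' \<in> Fam \<Xi> K K'" and fg': "is_inverse G1 G2 \<Xi> K K' f' g'"
    and cells: "cell_set G1 G2 \<Xi>"
    and K0: "\<And>y z v. v \<in> K y z \<Longrightarrow> y \<notin> Ob G1 \<Longrightarrow> v = 0"
    and b: "\<beta>1 \<in> Cells \<Xi>" "\<beta>2 \<in> Cells \<Xi>" "ctgt \<Xi> \<beta>1 = ctgt \<Xi> \<beta>2"
    and x: "x \<in> Ob G1" and t: "t \<in> (H \<odot> K) x (csrc \<Xi> \<beta>1)"
  shows "(\<Sum>\<beta>\<in>{\<beta> \<in> Cells \<Xi>. csrc \<Xi> \<beta> = x}.
      fusion_op \<Xi> g g' \<beta> \<beta>2 (fusion \<Xi> f f' \<beta>1 \<beta> t)) = (if \<beta>1 = \<beta>2 then t else 0)"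
proof -
  let ?S = "\<lambda>y. {\<beta> \<in> Cells \<Xi>. csrc \<Xi> \<beta> = y}" and ?T = "\<lambda>c. {\<beta> \<in> Cells \<Xi>. ctgt \<Xi> \<beta> = c}"
  note finS = cell_fibres_finite(1)[OF cells] and finT = cell_fibres_finite(2)[OF cells]
  have g: "g \<in> Fam_op \<Xi> H H'" and g': "g' \<in> Fam_op \<Xi> K K'"
    using fg fg' unfolding is_inverse_def by blast+
  note J = fusion_Fam[OF f f' finS] and Jop = fusion_op_Fam_op[OF g g' finT]
  have inv: "(\<Sum>\<beta>\<in>?S x. g \<beta> \<gamma>2 (f \<gamma>1 \<beta> u)) = (if \<gamma>1 = \<gamma>2 then u else 0)"
    if "\<gamma>1 \<in> Cells \<Xi>" "\<gamma>2 \<in> Cells \<Xi>" "ctgt \<Xi> \<gamma>1 = ctgt \<Xi> \<gamma>2" "u \<in> H x (csrc \<Xi> \<gamma>1)"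
    for \<gamma>1 \<gamma>2 u
    using fg x that unfolding is_inverse_def by blast
  have inv': "(\<Sum>\<beta>\<in>?S y. g' \<beta> \<beta>2 (f' \<beta>1 \<beta> v)) = (if \<beta>1 = \<beta>2 then v else 0)"
    if "y \<in> Ob G1" "v \<in> K y (csrc \<Xi> \<beta>1)" for v y
    using fg' b that unfolding is_inverse_def by blast
  show ?thesis
  proof (rule concat_eqI[where H = H and K = K, OF _ _ _ t])
    show "linear_on ((H \<odot> K) x (csrc \<Xi> \<beta>1))
      (\<lambda>t. \<Sum>\<beta>\<in>?S x. fusion_op \<Xi> g g' \<beta> \<beta>2 (fusion \<Xi> f f' \<beta>1 \<beta> t))"
    proof (rule linear_on_sum_maps)
      fix \<beta> assume "\<beta> \<in> ?S x"
      then have \<beta>: "\<beta> \<in> Cells \<Xi>" "csrc \<Xi> \<beta> = x" by blast+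
      show "linear_on ((H \<odot> K) x (csrc \<Xi> \<beta>1)) (\<lambda>t. fusion_op \<Xi> g g' \<beta> \<beta>2 (fusion \<Xi> f f' \<beta>1 \<beta> t))"
      proof (rule linear_on_compose[OF _ Fam_op_linear[OF Jop \<beta>(1) b(2)]])
        show "linear_on ((H \<odot> K) x (csrc \<Xi> \<beta>1)) (fusion \<Xi> f f' \<beta>1 \<beta>)"
          by (rule linear_on_subset[OF Fam_linear[OF J b(1) \<beta>(1)]]) (blast intro: in_tot[where H = "H \<odot> K"])
        show "fusion \<Xi> f f' \<beta>1 \<beta> ` (H \<odot> K) x (csrc \<Xi> \<beta>1) \<subseteq> tot (H' \<odot> K')"
          using Fam_in[OF J b(1) \<beta>(1)] in_tot[where H = "H' \<odot> K'"] unfolding \<beta>(2) by blast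
      qed
    qed
    show "linear_on ((H \<odot> K) x (csrc \<Xi> \<beta>1)) (\<lambda>t. if \<beta>1 = \<beta>2 then t else 0)"
      by (simp add: linear_on_def)
    fix u v y assume uv: "u \<in> H x y" "v \<in> K y (csrc \<Xi> \<beta>1)"
    have step: "fusion_op \<Xi> g g' \<beta> \<beta>2 (fusion \<Xi> f f' \<beta>1 \<beta> (u \<otimes>\<^sub>t v)) =
        (\<Sum>\<gamma>\<in>?S y. \<Sum>\<gamma>'\<in>?T (ctgt \<Xi> \<gamma>). g \<beta> \<gamma>' (f \<gamma> \<beta> u) \<otimes>\<^sub>t g' \<gamma>' \<beta>2 (f' \<beta>1 \<gamma> v))"
      if "\<beta> \<in> ?S x" for \<beta>
    proof -
      have \<beta>: "\<beta> \<in> Cells \<Xi>" "csrc \<Xi> \<beta> = x" using that by blast+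
      have fu: "f \<gamma> \<beta> u \<in> H' (ctgt \<Xi> \<beta>) (ctgt \<Xi> \<gamma>)" and fv: "f' \<beta>1 \<gamma> v \<in> K' (ctgt \<Xi> \<gamma>) (ctgt \<Xi> \<beta>1)"
        if "\<gamma> \<in> ?S y" for \<gamma>
      proof -
        have \<gamma>: "\<gamma> \<in> Cells \<Xi>" "csrc \<Xi> \<gamma> = y" using that by blast+
        show "f \<gamma> \<beta> u \<in> H' (ctgt \<Xi> \<beta>) (ctgt \<Xi> \<gamma>)"
          by (rule Fam_in[OF f \<gamma>(1) \<beta>(1)]) (simp only: \<gamma> \<beta> uv)
        show "f' \<beta>1 \<gamma> v \<in> K' (ctgt \<Xi> \<gamma>) (ctgt \<Xi> \<beta>1)"
          by (rule Fam_in[OF f' b(1) \<gamma>(1)]) (simp only: \<gamma> uv)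
      qed
      have "fusion_op \<Xi> g g' \<beta> \<beta>2 (fusion \<Xi> f f' \<beta>1 \<beta> (u \<otimes>\<^sub>t v)) =
          fusion_op \<Xi> g g' \<beta> \<beta>2 (\<Sum>\<gamma>\<in>?S y. f \<gamma> \<beta> u \<otimes>\<^sub>t f' \<beta>1 \<gamma> v)"
        by (simp only: fusion_tens[where H = H and K = K, OF f f' finS b(1) \<beta>(1) uv])
      also have "\<dots> = (\<Sum>\<gamma>\<in>?S y. fusion_op \<Xi> g g' \<beta> \<beta>2 (f \<gamma> \<beta> u \<otimes>\<^sub>t f' \<beta>1 \<gamma> v))"
        by (rule linear_on_sum[OF Fam_op_linear[OF Jop \<beta>(1) b(2)] subspace_tot])
          (rule in_tot[where H = "H' \<odot> K'"], rule tens_in_concat[where H = H' and K = K'], erule fu, erule fv)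
      also have "\<dots> = (\<Sum>\<gamma>\<in>?S y. \<Sum>\<gamma>'\<in>?T (ctgt \<Xi> \<gamma>). g \<beta> \<gamma>' (f \<gamma> \<beta> u) \<otimes>\<^sub>t g' \<gamma>' \<beta>2 (f' \<beta>1 \<gamma> v))"
        by (rule sum.cong[OF refl])
          (rule fusion_op_tens[where H' = H' and K' = K', OF g g' finT \<beta>(1) b(2)], erule fu, erule fv)
      finally show ?thesis .
    qed
    have "(\<Sum>\<beta>\<in>?S x. fusion_op \<Xi> g g' \<beta> \<beta>2 (fusion \<Xi> f f' \<beta>1 \<beta> (u \<otimes>\<^sub>t v))) =
        (\<Sum>\<beta>\<in>?S x. \<Sum>\<gamma>\<in>?S y. \<Sum>\<gamma>'\<in>?T (ctgt \<Xi> \<gamma>). g \<beta> \<gamma>' (f \<gamma> \<beta> u) \<otimes>\<^sub>t g' \<gamma>' \<beta>2 (f' \<beta>1 \<gamma> v))"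
      by (rule sum.cong[OF refl step])
    also have "\<dots> = (\<Sum>\<gamma>\<in>?S y. \<Sum>\<beta>\<in>?S x. \<Sum>\<gamma>'\<in>?T (ctgt \<Xi> \<gamma>).
        g \<beta> \<gamma>' (f \<gamma> \<beta> u) \<otimes>\<^sub>t g' \<gamma>' \<beta>2 (f' \<beta>1 \<gamma> v))"
      by (rule sum.swap)
    also have "\<dots> = (\<Sum>\<gamma>\<in>?S y. \<Sum>\<gamma>'\<in>?T (ctgt \<Xi> \<gamma>). \<Sum>\<beta>\<in>?S x.
        g \<beta> \<gamma>' (f \<gamma> \<beta> u) \<otimes>\<^sub>t g' \<gamma>' \<beta>2 (f' \<beta>1 \<gamma> v))"
      by (rule sum.cong[OF refl sum.swap])
    also have "\<dots> = (\<Sum>\<gamma>\<in>?S y. u \<otimes>\<^sub>t g' \<gamma> \<beta>2 (f' \<beta>1 \<gamma> v))"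
    proof (rule sum.cong[OF refl])
      fix \<gamma> assume "\<gamma> \<in> ?S y"
      then have \<gamma>: "\<gamma> \<in> Cells \<Xi>" "csrc \<Xi> \<gamma> = y" by blast+
      have "(\<Sum>\<beta>\<in>?S x. g \<beta> \<gamma>' (f \<gamma> \<beta> u) \<otimes>\<^sub>t g' \<gamma>' \<beta>2 (f' \<beta>1 \<gamma> v)) =
          (if \<gamma> = \<gamma>' then u \<otimes>\<^sub>t g' \<gamma>' \<beta>2 (f' \<beta>1 \<gamma> v) else 0)" if "\<gamma>' \<in> ?T (ctgt \<Xi> \<gamma>)" for \<gamma>'
      proof -
        have \<gamma>': "\<gamma>' \<in> Cells \<Xi>" "ctgt \<Xi> \<gamma> = ctgt \<Xi> \<gamma>'" using that by auto
        have u: "u \<in> H x (csrc \<Xi> \<gamma>)" by (simp only: uv \<gamma>)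
        show ?thesis
          unfolding tens_sum_left[symmetric] inv[OF \<gamma>(1) \<gamma>' u]
          by (cases "\<gamma> = \<gamma>'") simp_all
      qed
      then have "(\<Sum>\<gamma>'\<in>?T (ctgt \<Xi> \<gamma>). \<Sum>\<beta>\<in>?S x.
          g \<beta> \<gamma>' (f \<gamma> \<beta> u) \<otimes>\<^sub>t g' \<gamma>' \<beta>2 (f' \<beta>1 \<gamma> v)) =
          (\<Sum>\<gamma>'\<in>?T (ctgt \<Xi> \<gamma>). if \<gamma> = \<gamma>' then u \<otimes>\<^sub>t g' \<gamma>' \<beta>2 (f' \<beta>1 \<gamma> v) else 0)"
        by (rule sum.cong[OF refl])
      also have "\<dots> = u \<otimes>\<^sub>t g' \<gamma> \<beta>2 (f' \<beta>1 \<gamma> v)"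
        unfolding sum.delta'[OF finT] using \<gamma> by simp
      finally show "(\<Sum>\<gamma>'\<in>?T (ctgt \<Xi> \<gamma>). \<Sum>\<beta>\<in>?S x.
          g \<beta> \<gamma>' (f \<gamma> \<beta> u) \<otimes>\<^sub>t g' \<gamma>' \<beta>2 (f' \<beta>1 \<gamma> v)) = u \<otimes>\<^sub>t g' \<gamma> \<beta>2 (f' \<beta>1 \<gamma> v)" .
    qed
    also have "\<dots> = u \<otimes>\<^sub>t (\<Sum>\<gamma>\<in>?S y. g' \<gamma> \<beta>2 (f' \<beta>1 \<gamma> v))" by (simp only: tens_sum_right)
    also have "\<dots> = (if \<beta>1 = \<beta>2 then u \<otimes>\<^sub>t v else 0)"
    proof (cases "y \<in> Ob G1")
      case True
      show ?thesis
        unfolding inv'[OF True uv(2)]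
        by (cases "\<beta>1 = \<beta>2") simp_all
    next
      case False
      \<comment> \<open>Outside the objects both sides are zero; the inversion rule speaks of objects only.\<close>
      then have "?S y = {}" using cells unfolding cell_set_def by blast
      then have "u \<otimes>\<^sub>t (\<Sum>\<gamma>\<in>?S y. g' \<gamma> \<beta>2 (f' \<beta>1 \<gamma> v)) = 0"
        by (simp only: sum.empty tens_zero)
      moreover have "v = 0" using K0[OF uv(2) False] .
      ultimately show ?thesis by (simp only: tens_zero if_cancel)
    qed
    finally show "(\<Sum>\<beta>\<in>?S x. fusion_op \<Xi> g g' \<beta> \<beta>2 (fusion \<Xi> f f' \<beta>1 \<beta> (u \<otimes>\<^sub>t v))) =
      (if \<beta>1 = \<beta>2 then u \<otimes>\<^sub>t v else 0)" .
  qed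
qed

text \<open>
  The sum on the left is the twisted operator at \<open>\<beta>3\<close>.  The trick is to add the operators from all cells
  \<open>\<beta>2\<close> over the same source as \<open>\<beta>3\<close>, which contribute nothing, since only the full sum over \<open>\<beta>2\<close>
  lets the inversion of the fusion square act.
\<close>

lemma twist_absorbs_fusion:
  assumes f: "f \<in> Fam \<Xi> H H'" and fg: "is_inverse G1 G2 \<Xi> H H' f g"
    and cells: "cell_set G1 G2 \<Xi>"
    and H0: "\<And>y z v. v \<in> H y z \<Longrightarrow> y \<notin> Ob G1 \<Longrightarrow> v = 0"
    and R: "R \<in> Hom (H \<odot> H) (H \<odot> H)"
    and \<beta>: "\<beta> \<in> Cells \<Xi>" and \<beta>3: "\<beta>3 \<in> Cells \<Xi>"
    and off_diagonal: "\<And>\<beta>2 s. \<beta>2 \<in> Cells \<Xi> \<Longrightarrow> csrc \<Xi> \<beta>2 = csrc \<Xi> \<beta>3 \<Longrightarrow> \<beta>2 \<noteq> \<beta>3 \<Longrightarrow>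
      s \<in> (H' \<odot> H') (ctgt \<Xi> \<beta>2) (ctgt \<Xi> \<beta>) \<Longrightarrow>
      (\<Sum>\<beta>'\<in>{\<beta>' \<in> Cells \<Xi>. ctgt \<Xi> \<beta>' = ctgt \<Xi> \<beta>}.
        fusion \<Xi> f f \<beta>' \<beta>3 (R (fusion_op \<Xi> g g \<beta>2 \<beta>' s))) = 0"
    and t: "t \<in> (H \<odot> H) (csrc \<Xi> \<beta>3) (csrc \<Xi> \<beta>)"
  shows "(\<Sum>\<beta>'\<in>{\<beta>' \<in> Cells \<Xi>. ctgt \<Xi> \<beta>' = ctgt \<Xi> \<beta>}.
      fusion \<Xi> f f \<beta>' \<beta>3 (R (fusion_op \<Xi> g g \<beta>3 \<beta>' (fusion \<Xi> f f \<beta> \<beta>3 t)))) =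
    fusion \<Xi> f f \<beta> \<beta>3 (R t)"
proof -
  let ?S = "{\<beta>2 \<in> Cells \<Xi>. csrc \<Xi> \<beta>2 = csrc \<Xi> \<beta>3}"
  let ?T = "{\<beta>' \<in> Cells \<Xi>. ctgt \<Xi> \<beta>' = ctgt \<Xi> \<beta>}"
  let ?J = "fusion \<Xi> f f" and ?I = "fusion_op \<Xi> g g"
  note finS = cell_fibres_finite(1)[OF cells] and finT = cell_fibres_finite(2)[OF cells]
  have g: "g \<in> Fam_op \<Xi> H H'" using fg unfolding is_inverse_def by blast
  note J = fusion_Fam[OF f f finS] and I = fusion_op_Fam_op[OF g g finT]
  have x: "csrc \<Xi> \<beta>3 \<in> Ob G1" using cells \<beta>3 unfolding cell_set_def by blast
  have Jt: "?J \<beta> \<beta>2 t \<in> (H' \<odot> H') (ctgt \<Xi> \<beta>2) (ctgt \<Xi> \<beta>)" if "\<beta>2 \<in> ?S" for \<beta>2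
  proof -
    have \<beta>2: "\<beta>2 \<in> Cells \<Xi>" "csrc \<Xi> \<beta>2 = csrc \<Xi> \<beta>3" using that by blast+
    show ?thesis by (rule Fam_in[OF J \<beta> \<beta>2(1)]) (simp only: \<beta>2 t)
  qed
  have It: "?I \<beta>2 \<beta>' (?J \<beta> \<beta>2 t) \<in> tot (H \<odot> H)" if "\<beta>2 \<in> ?S" "\<beta>' \<in> ?T" for \<beta>2 \<beta>'
  proof -
    have b: "\<beta>2 \<in> Cells \<Xi>" "\<beta>' \<in> Cells \<Xi>" "ctgt \<Xi> \<beta>' = ctgt \<Xi> \<beta>" using that by blast+
    show ?thesis
      by (rule in_tot[where H = "H \<odot> H"], rule Fam_op_in[OF I b(1,2)]) (simp only: b(3) Jt[OF that(1)])
  qed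
  have "(\<Sum>\<beta>'\<in>?T. ?J \<beta>' \<beta>3 (R (?I \<beta>3 \<beta>' (?J \<beta> \<beta>3 t)))) =
      (\<Sum>\<beta>2\<in>{\<beta>3}. \<Sum>\<beta>'\<in>?T. ?J \<beta>' \<beta>3 (R (?I \<beta>2 \<beta>' (?J \<beta> \<beta>2 t))))" by simp
  \<comment> \<open>The terms added here are the off-diagonal ones, which are zero.\<close>
  also have "\<dots> = (\<Sum>\<beta>2\<in>?S. \<Sum>\<beta>'\<in>?T. ?J \<beta>' \<beta>3 (R (?I \<beta>2 \<beta>' (?J \<beta> \<beta>2 t))))"
  proof (rule sum.mono_neutral_left[OF finS])
    show "{\<beta>3} \<subseteq> ?S" using \<beta>3 by blast
    show "\<forall>\<beta>2\<in>?S - {\<beta>3}. (\<Sum>\<beta>'\<in>?T. ?J \<beta>' \<beta>3 (R (?I \<beta>2 \<beta>' (?J \<beta> \<beta>2 t)))) = 0"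
      using off_diagonal Jt by blast
  qed
  also have "\<dots> = (\<Sum>\<beta>'\<in>?T. \<Sum>\<beta>2\<in>?S. ?J \<beta>' \<beta>3 (R (?I \<beta>2 \<beta>' (?J \<beta> \<beta>2 t))))"
    by (rule sum.swap)
  also have "\<dots> = (\<Sum>\<beta>'\<in>?T. if \<beta> = \<beta>' then ?J \<beta>' \<beta>3 (R t) else 0)"
  proof (rule sum.cong[OF refl])
    fix \<beta>' assume T: "\<beta>' \<in> ?T"
    then have \<beta>': "\<beta>' \<in> Cells \<Xi>" "ctgt \<Xi> \<beta> = ctgt \<Xi> \<beta>'" by auto
    have lin: "linear_on (tot (H \<odot> H)) (\<lambda>s. ?J \<beta>' \<beta>3 (R s))"
      by (rule linear_on_compose[OF Hom_linear[OF R] Fam_linear[OF J \<beta>'(1) \<beta>3] Hom_tot[OF R]])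
    have "(\<Sum>\<beta>2\<in>?S. ?J \<beta>' \<beta>3 (R (?I \<beta>2 \<beta>' (?J \<beta> \<beta>2 t)))) =
        ?J \<beta>' \<beta>3 (R (\<Sum>\<beta>2\<in>?S. ?I \<beta>2 \<beta>' (?J \<beta> \<beta>2 t)))"
      by (rule linear_on_sum[OF lin subspace_tot, symmetric]) (rule It[OF _ T])
    also have "\<dots> = ?J \<beta>' \<beta>3 (R (if \<beta> = \<beta>' then t else 0))"
      by (subst fusion_left_inverse[where H = H and K = H, OF f fg f fg cells _ \<beta> \<beta>' x t])
        (erule H0, assumption, rule refl)
    also have "\<dots> = (if \<beta> = \<beta>' then ?J \<beta>' \<beta>3 (R t) else 0)"
      using linear_on_0[OF lin fv.subspace_0[OF subspace_tot]] by (simp only: split: if_split) blast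
    finally show "(\<Sum>\<beta>2\<in>?S. ?J \<beta>' \<beta>3 (R (?I \<beta>2 \<beta>' (?J \<beta> \<beta>2 t)))) =
      (if \<beta> = \<beta>' then ?J \<beta>' \<beta>3 (R t) else 0)" .
  qed
  also have "\<dots> = ?J \<beta> \<beta>3 (R t)"
    unfolding sum.delta'[OF finT] using \<beta> by simp
  finally show ?thesis .
qed

section \<open>The intertwiner attached to a family\<close>

text \<open>
  The map \<open>x \<otimes> e\<^sub>\<beta>\<^sub>1 \<mapsto> \<Sum>\<beta>2. e\<^sub>\<beta>\<^sub>2 \<otimes> f \<beta>1 \<beta>2 x\<close>, written in coordinates so that it is defined on all
  tensors at once: the slice of a tensor at \<open>\<beta>1\<close> is its coefficient of \<open>e\<^sub>\<beta>\<^sub>1\<close>.  The restriction of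
  \<open>\<beta>2\<close> to the source of \<open>x\<close> is not imposed, since \<open>f \<beta>1 \<beta>2\<close> vanishes on \<open>x\<close> otherwise.
\<close>

definition cell_intertwiner ::
  "('p, 'o, 'q) cells \<Rightarrow> ('p, 'k, 'l) family \<Rightarrow> ('k \<times> 'p) tvec \<Rightarrow> ('p \<times> 'l) tvec" where
  "cell_intertwiner \<Xi> f t = (\<lambda>(\<beta>2, q).
     if \<beta>2 \<in> Cells \<Xi> then lsum (Cells \<Xi>) (\<lambda>\<beta>1. f \<beta>1 \<beta>2 (\<lambda>p. t (p, \<beta>1))) q else 0)"

lemma cell_strings_generators:
  "cell_strings \<Xi> = (\<lambda>x c. fv.span {unit_vec \<beta> | \<beta>. \<beta> \<in> Cells \<Xi> \<and> csrc \<Xi> \<beta> = x \<and> ctgt \<Xi> \<beta> = c})"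
  by (intro ext) (simp only: cell_strings_def)

lemma unit_vec_in_cell_strings: "\<beta> \<in> Cells \<Xi> \<Longrightarrow> unit_vec \<beta> \<in> cell_strings \<Xi> (csrc \<Xi> \<beta>) (ctgt \<Xi> \<beta>)"
  unfolding cell_strings_def by (rule fv.span_base) blast

lemma concat_cell_generators:
  assumes "\<And>x y. fv.subspace (H x y)"
  shows "H \<odot> cell_strings \<Xi> = (\<lambda>x c. fv.span {u \<otimes>\<^sub>t e | u e. \<exists>y. u \<in> H x y \<and>
      e \<in> {unit_vec \<beta> | \<beta>. \<beta> \<in> Cells \<Xi> \<and> csrc \<Xi> \<beta> = y \<and> ctgt \<Xi> \<beta> = c}})"
  unfolding cell_strings_generators
  by (intro ext) (rule concat_tens_span[where A = H, unfolded span_components[of H, OF assms]])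

lemma slice_unit_vec: "(\<lambda>p. (u \<otimes>\<^sub>t unit_vec \<beta>) (p, \<beta>')) = (if \<beta>' = \<beta> then u else 0)"
  by (auto simp: tens_def unit_vec_def fun_eq_iff)

lemma cell_intertwiner_tens:
  assumes f: "f \<in> Fam \<Xi> H K" and fin: "finite {\<beta> \<in> Cells \<Xi>. csrc \<Xi> \<beta> = x}"
    and u: "u \<in> H x y" and \<beta>1: "\<beta>1 \<in> Cells \<Xi>"
  shows "cell_intertwiner \<Xi> f (u \<otimes>\<^sub>t unit_vec \<beta>1) =
    (\<Sum>\<beta>2\<in>{\<beta>2 \<in> Cells \<Xi>. csrc \<Xi> \<beta>2 = x}. unit_vec \<beta>2 \<otimes>\<^sub>t f \<beta>1 \<beta>2 u)"
proof (intro ext, clarify)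
  fix \<beta> q
  let ?S = "{\<beta>2 \<in> Cells \<Xi>. csrc \<Xi> \<beta>2 = x}"
  have "(\<Sum>\<beta>2\<in>?S. unit_vec \<beta>2 \<otimes>\<^sub>t f \<beta>1 \<beta>2 u) (\<beta>, q) =
      (\<Sum>\<beta>2\<in>?S. if \<beta> = \<beta>2 then f \<beta>1 \<beta>2 u q else 0)"
    unfolding sum_vec_apply by (rule sum.cong) (auto simp: tens_def unit_vec_def)
  also have "\<dots> = (if \<beta> \<in> ?S then f \<beta>1 \<beta> u q else 0)" by (rule sum.delta'[OF fin])
  also have "\<dots> = cell_intertwiner \<Xi> f (u \<otimes>\<^sub>t unit_vec \<beta>1) (\<beta>, q)"
  proof (cases "\<beta> \<in> Cells \<Xi>")
    case True
    have f0: "f \<beta>' \<beta> 0 = 0" if "\<beta>' \<in> Cells \<Xi>" for \<beta>'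
      by (rule linear_on_0[OF Fam_linear[OF f that True] fv.subspace_0[OF subspace_tot]])
    have "lsum (Cells \<Xi>) (\<lambda>\<beta>'. f \<beta>' \<beta> (\<lambda>p. (u \<otimes>\<^sub>t unit_vec \<beta>1) (p, \<beta>'))) =
        (\<Sum>\<beta>'\<in>{\<beta>1}. f \<beta>' \<beta> (\<lambda>p. (u \<otimes>\<^sub>t unit_vec \<beta>1) (p, \<beta>')))"
      unfolding slice_unit_vec by (rule lsum_eq_sum) (use \<beta>1 f0 in auto)
    also have "\<dots> = f \<beta>1 \<beta> u" unfolding slice_unit_vec by simp
    finally have "cell_intertwiner \<Xi> f (u \<otimes>\<^sub>t unit_vec \<beta>1) (\<beta>, q) = f \<beta>1 \<beta> u q"
      using True by (simp add: cell_intertwiner_def)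
    moreover have "f \<beta>1 \<beta> u = 0" if "csrc \<Xi> \<beta> \<noteq> x"
      using Fam_zero[where H = H, OF f \<beta>1 True u] that by blast
    ultimately show ?thesis using True by auto
  next
    case False
    then show ?thesis by (simp add: cell_intertwiner_def)
  qed
  finally show "cell_intertwiner \<Xi> f (u \<otimes>\<^sub>t unit_vec \<beta>1) (\<beta>, q) =
    (\<Sum>\<beta>2\<in>?S. unit_vec \<beta>2 \<otimes>\<^sub>t f \<beta>1 \<beta>2 u) (\<beta>, q)" by (rule sym)
qed

lemma cell_intertwiner_Hom:
  assumes f: "f \<in> Fam \<Xi> H K" and fin: "\<And>x. finite {\<beta> \<in> Cells \<Xi>. csrc \<Xi> \<beta> = x}"
    and H: "\<And>x y. fv.subspace (H x y)"
  shows "cell_intertwiner \<Xi> f \<in> Hom (H \<odot> cell_strings \<Xi>) (cell_strings \<Xi> \<odot> K)"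
proof (rule HomI[OF _ concat_cell_generators[OF H] _ subspace_concat])
  let ?B = "\<Union>x c. {u \<otimes>\<^sub>t e | u e. \<exists>y. u \<in> H x y \<and>
      e \<in> {unit_vec \<beta> | \<beta>. \<beta> \<in> Cells \<Xi> \<and> csrc \<Xi> \<beta> = y \<and> ctgt \<Xi> \<beta> = c}}"
  have tot: "tot (H \<odot> cell_strings \<Xi>) = fv.span ?B"
    unfolding concat_cell_generators[OF H] tot_span by (rule refl)
  have lin: "linear_on (fv.span ?B) (\<lambda>t. lsum (Cells \<Xi>) (\<lambda>\<beta>1. f \<beta>1 \<beta>2 (\<lambda>p. t (p, \<beta>1))))"
    if \<beta>2: "\<beta>2 \<in> Cells \<Xi>" for \<beta>2
  proof (rule linear_on_lsum)
    fix \<beta>1 assume \<beta>1: "\<beta>1 \<in> Cells \<Xi>"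
    show "linear_on (fv.span ?B) (\<lambda>t. f \<beta>1 \<beta>2 (\<lambda>p. t (p, \<beta>1)))"
    proof (rule linear_on_compose[OF _ Fam_linear[OF f \<beta>1 \<beta>2]])
      show "linear_on (fv.span ?B) (\<lambda>t p. t (p, \<beta>1))"
        by (simp add: linear_on_def fun_eq_iff scl_def)
      show "(\<lambda>t p. t (p, \<beta>1)) ` fv.span ?B \<subseteq> tot H"
        unfolding tot[symmetric] by (rule image_subsetI) (rule slice_left)
    qed
  next
    fix t assume "t \<in> ?B"
    then obtain u \<beta> where t: "t = u \<otimes>\<^sub>t unit_vec \<beta>" by blast
    have "f \<beta>1 \<beta>2 0 = 0" if "\<beta>1 \<in> Cells \<Xi>" for \<beta>1
      by (rule linear_on_0[OF Fam_linear[OF f that \<beta>2] fv.subspace_0[OF subspace_tot]])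
    then have "{\<beta>1 \<in> Cells \<Xi>. f \<beta>1 \<beta>2 (\<lambda>p. t (p, \<beta>1)) \<noteq> 0} \<subseteq> {\<beta>}"
      unfolding t slice_unit_vec by auto
    then show "finite {\<beta>1 \<in> Cells \<Xi>. f \<beta>1 \<beta>2 (\<lambda>p. t (p, \<beta>1)) \<noteq> 0}"
      by (rule finite_subset) simp
  qed
  show "linear_on (tot (H \<odot> cell_strings \<Xi>)) (cell_intertwiner \<Xi> f)"
    unfolding tot
  proof (rule linear_onI; intro ext; clarify)
    fix u v \<beta> q assume uv: "u \<in> fv.span ?B" "v \<in> fv.span ?B"
    show "cell_intertwiner \<Xi> f (u + v) (\<beta>, q) =
        (cell_intertwiner \<Xi> f u + cell_intertwiner \<Xi> f v) (\<beta>, q)"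
    proof (cases "\<beta> \<in> Cells \<Xi>")
      case True
      show ?thesis
        using fun_cong[OF linear_on_add[OF lin[OF True] uv], of q] True
        by (simp add: cell_intertwiner_def)
    qed (simp add: cell_intertwiner_def)
  next
    fix c u \<beta> q assume u: "u \<in> fv.span ?B"
    show "cell_intertwiner \<Xi> f (scl c u) (\<beta>, q) = scl c (cell_intertwiner \<Xi> f u) (\<beta>, q)"
    proof (cases "\<beta> \<in> Cells \<Xi>")
      case True
      show ?thesis
        using fun_cong[OF linear_on_scl[OF lin[OF True] u, of c], of q] True
        by (simp add: cell_intertwiner_def scl_def)
    qed (simp add: cell_intertwiner_def scl_def)
  qed
  fix x c a assume "a \<in> {u \<otimes>\<^sub>t e | u e. \<exists>y. u \<in> H x y \<and>
      e \<in> {unit_vec \<beta> | \<beta>. \<beta> \<in> Cells \<Xi> \<and> csrc \<Xi> \<beta> = y \<and> ctgt \<Xi> \<beta> = c}}"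
  then obtain u \<beta> where a: "a = u \<otimes>\<^sub>t unit_vec \<beta>" and u: "u \<in> H x (csrc \<Xi> \<beta>)"
    and \<beta>: "\<beta> \<in> Cells \<Xi>" and c: "ctgt \<Xi> \<beta> = c" by blast
  have "unit_vec \<beta>2 \<otimes>\<^sub>t f \<beta> \<beta>2 u \<in> (cell_strings \<Xi> \<odot> K) x c"
    if "\<beta>2 \<in> {\<beta>2 \<in> Cells \<Xi>. csrc \<Xi> \<beta>2 = x}" for \<beta>2
  proof -
    have \<beta>2: "\<beta>2 \<in> Cells \<Xi>" "csrc \<Xi> \<beta>2 = x" using that by blast+
    have "f \<beta> \<beta>2 u \<in> K (ctgt \<Xi> \<beta>2) (ctgt \<Xi> \<beta>)"
      by (rule Fam_in[OF f \<beta> \<beta>2(1)]) (simp only: \<beta>2 u)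
    then show ?thesis
      using tens_in_concat[where H = "cell_strings \<Xi>" and K = K, OF unit_vec_in_cell_strings[OF \<beta>2(1)]]
      unfolding c \<beta>2(2) by blast
  qed
  then show "cell_intertwiner \<Xi> f a \<in> (cell_strings \<Xi> \<odot> K) x c"
    unfolding a cell_intertwiner_tens[where H = H, OF f fin u \<beta>]
    by (rule fv.subspace_sum[OF subspace_concat])
qed

text \<open>
  Carrying \<open>e\<^sub>\<beta>\<close> past \<open>v\<close> turns it into \<open>e\<^sub>\<beta>\<^sub>1\<close> with \<open>\<beta>1\<close> over the middle vertex, and carrying \<open>e\<^sub>\<beta>\<^sub>1\<close> past
  \<open>u\<close> turns it into \<open>e\<^sub>\<beta>\<^sub>2\<close>.  Collecting the terms with fixed \<open>\<beta>2\<close> gives the sum over \<open>\<beta>1\<close> that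
  defines the fusion square.
\<close>

lemma double_intertwiner_fusion:
  assumes f: "f \<in> Fam \<Xi> H K" and fin: "\<And>x. finite {\<beta> \<in> Cells \<Xi>. csrc \<Xi> \<beta> = x}"
    and H: "\<And>x y. fv.subspace (H x y)"
    and \<beta>: "\<beta> \<in> Cells \<Xi>" and t: "t \<in> (H \<odot> H) x (csrc \<Xi> \<beta>)"
  defines "C \<equiv> cell_intertwiner \<Xi> f"
  shows "act12 C (act23 C (assoc_right (t \<otimes>\<^sub>t unit_vec \<beta>))) =
    (\<Sum>\<beta>2\<in>{\<beta>2 \<in> Cells \<Xi>. csrc \<Xi> \<beta>2 = x}. unit_vec \<beta>2 \<otimes>\<^sub>t fusion \<Xi> f f \<beta> \<beta>2 t)"
proof (rule concat_eqI[where H = H and K = H, OF _ _ _ t])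
  let ?S = "\<lambda>x. {\<beta>2 \<in> Cells \<Xi>. csrc \<Xi> \<beta>2 = x}" and ?E = "cell_strings \<Xi>"
  note J = fusion_Fam[OF f f fin]
  have C: "C \<in> Hom (H \<odot> ?E) (?E \<odot> K)"
    unfolding C_def by (rule cell_intertwiner_Hom[OF f fin H])
  have D: "(\<lambda>t. act12 C (act23 C t)) \<in> Hom (H \<odot> H \<odot> ?E) (?E \<odot> K \<odot> K)"
    by (rule Hom_compose[OF act23_Hom[OF C] act12_Hom[OF C H]])
  have "linear_on ((H \<odot> H) x (csrc \<Xi> \<beta>)) (\<lambda>t. assoc_right (t \<otimes>\<^sub>t unit_vec \<beta>))"
    by (rule linear_on_compose[OF linear_on_tens_left linear_on_assoc_right subset_UNIV])
  moreover have "(\<lambda>t. assoc_right (t \<otimes>\<^sub>t unit_vec \<beta>)) ` (H \<odot> H) x (csrc \<Xi> \<beta>) \<subseteq> tot (H \<odot> H \<odot> ?E)"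
    using in_tot[where H = "H \<odot> H \<odot> ?E",
        OF assoc_right_concat[where H = H and K = H and M = ?E, OF _ unit_vec_in_cell_strings[OF \<beta>]]] by blast
  ultimately show "linear_on ((H \<odot> H) x (csrc \<Xi> \<beta>))
      (\<lambda>t. act12 C (act23 C (assoc_right (t \<otimes>\<^sub>t unit_vec \<beta>))))"
    by (rule linear_on_compose[OF _ Hom_linear[OF D]])
  show "linear_on ((H \<odot> H) x (csrc \<Xi> \<beta>))
      (\<lambda>t. \<Sum>\<beta>2\<in>?S x. unit_vec \<beta>2 \<otimes>\<^sub>t fusion \<Xi> f f \<beta> \<beta>2 t)"
  proof (rule linear_on_sum_maps)
    fix \<beta>2 assume "\<beta>2 \<in> ?S x"
    then have \<beta>2: "\<beta>2 \<in> Cells \<Xi>" by blast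
    have "linear_on ((H \<odot> H) x (csrc \<Xi> \<beta>)) (fusion \<Xi> f f \<beta> \<beta>2)"
      by (rule linear_on_subset[OF Fam_linear[OF J \<beta> \<beta>2]]) (blast intro: in_tot[where H = "H \<odot> H"])
    then show "linear_on ((H \<odot> H) x (csrc \<Xi> \<beta>)) (\<lambda>t. unit_vec \<beta>2 \<otimes>\<^sub>t fusion \<Xi> f f \<beta> \<beta>2 t)"
      by (rule linear_on_compose[OF _ linear_on_tens_right subset_UNIV])
  qed
  fix u v y assume uv: "u \<in> H x y" "v \<in> H y (csrc \<Xi> \<beta>)"
  have ve: "v \<otimes>\<^sub>t unit_vec \<beta> \<in> tot (H \<odot> ?E)"
    by (rule in_tot[where H = "H \<odot> ?E",
          OF tens_in_concat[where H = H and K = ?E, OF uv(2) unit_vec_in_cell_strings[OF \<beta>]]])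
  have mid: "u \<otimes>\<^sub>t unit_vec \<beta>1 \<in> (H \<odot> ?E) x (ctgt \<Xi> \<beta>1)" if "\<beta>1 \<in> ?S y" for \<beta>1
  proof -
    have \<beta>1: "\<beta>1 \<in> Cells \<Xi>" "csrc \<Xi> \<beta>1 = y" using that by blast+
    show ?thesis
      by (rule tens_in_concat[where H = H and K = ?E, OF uv(1)
            unit_vec_in_cell_strings[OF \<beta>1(1), unfolded \<beta>1(2)]])
  qed
  have fv: "f \<beta> \<beta>1 v \<in> K (ctgt \<Xi> \<beta>1) (ctgt \<Xi> \<beta>)" if "\<beta>1 \<in> ?S y" for \<beta>1
  proof -
    have \<beta>1: "\<beta>1 \<in> Cells \<Xi>" "csrc \<Xi> \<beta>1 = y" using that by blast+
    show ?thesis by (rule Fam_in[OF f \<beta> \<beta>1(1)]) (simp only: \<beta>1 uv)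
  qed
  have inner: "act23 C (assoc_right ((u \<otimes>\<^sub>t v) \<otimes>\<^sub>t unit_vec \<beta>)) =
      (\<Sum>\<beta>1\<in>?S y. assoc_right ((u \<otimes>\<^sub>t unit_vec \<beta>1) \<otimes>\<^sub>t f \<beta> \<beta>1 v))"
    unfolding assoc_right_tens act23_def
    unfolding act_right_tens[OF Hom_linear[OF C] ve]
    unfolding C_def cell_intertwiner_tens[where H = H, OF f fin uv(2) \<beta>]
    by (rule tens_sum_right)
  have outer: "act12 C (assoc_right ((u \<otimes>\<^sub>t unit_vec \<beta>1) \<otimes>\<^sub>t f \<beta> \<beta>1 v)) =
      (\<Sum>\<beta>2\<in>?S x. unit_vec \<beta>2 \<otimes>\<^sub>t f \<beta>1 \<beta>2 u \<otimes>\<^sub>t f \<beta> \<beta>1 v)" if "\<beta>1 \<in> ?S y" for \<beta>1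
  proof -
    have \<beta>1: "\<beta>1 \<in> Cells \<Xi>" using that by blast
    have "act12 C (assoc_right ((u \<otimes>\<^sub>t unit_vec \<beta>1) \<otimes>\<^sub>t f \<beta> \<beta>1 v)) =
        assoc_right (C (u \<otimes>\<^sub>t unit_vec \<beta>1) \<otimes>\<^sub>t f \<beta> \<beta>1 v)"
      by (rule act12_tens[OF Hom_linear[OF C] in_tot[where H = "H \<odot> ?E", OF mid[OF that]]])
    also have "\<dots> = assoc_right (\<Sum>\<beta>2\<in>?S x. (unit_vec \<beta>2 \<otimes>\<^sub>t f \<beta>1 \<beta>2 u) \<otimes>\<^sub>t f \<beta> \<beta>1 v)"
      unfolding C_def cell_intertwiner_tens[where H = H, OF f fin uv(1) \<beta>1]
      by (simp only: tens_sum_left)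
    also have "\<dots> = (\<Sum>\<beta>2\<in>?S x. assoc_right ((unit_vec \<beta>2 \<otimes>\<^sub>t f \<beta>1 \<beta>2 u) \<otimes>\<^sub>t f \<beta> \<beta>1 v))"
      by (rule linear_on_sum[OF linear_on_assoc_right fv.subspace_UNIV UNIV_I])
    finally show ?thesis by (simp only: assoc_right_tens)
  qed
  have "act12 C (act23 C (assoc_right ((u \<otimes>\<^sub>t v) \<otimes>\<^sub>t unit_vec \<beta>))) =
      (\<Sum>\<beta>1\<in>?S y. act12 C (assoc_right ((u \<otimes>\<^sub>t unit_vec \<beta>1) \<otimes>\<^sub>t f \<beta> \<beta>1 v)))"
    unfolding inner
  proof (rule linear_on_sum[OF Hom_linear[OF act12_Hom[OF C H, of K]] subspace_tot])
    fix \<beta>1 assume "\<beta>1 \<in> ?S y"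
    then show "assoc_right ((u \<otimes>\<^sub>t unit_vec \<beta>1) \<otimes>\<^sub>t f \<beta> \<beta>1 v) \<in> tot (H \<odot> ?E \<odot> K)"
      using in_tot[where H = "H \<odot> ?E \<odot> K",
        OF assoc_right_concat[where H = H and K = ?E and M = K, OF mid fv]] by blast
  qed
  also have "\<dots> = (\<Sum>\<beta>1\<in>?S y. \<Sum>\<beta>2\<in>?S x. unit_vec \<beta>2 \<otimes>\<^sub>t f \<beta>1 \<beta>2 u \<otimes>\<^sub>t f \<beta> \<beta>1 v)"
    by (rule sum.cong[OF refl outer])
  also have "\<dots> = (\<Sum>\<beta>2\<in>?S x. \<Sum>\<beta>1\<in>?S y. unit_vec \<beta>2 \<otimes>\<^sub>t f \<beta>1 \<beta>2 u \<otimes>\<^sub>t f \<beta> \<beta>1 v)"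
    by (rule sum.swap)
  also have "\<dots> = (\<Sum>\<beta>2\<in>?S x. unit_vec \<beta>2 \<otimes>\<^sub>t fusion \<Xi> f f \<beta> \<beta>2 (u \<otimes>\<^sub>t v))"
  proof (rule sum.cong[OF refl])
    fix \<beta>2 assume "\<beta>2 \<in> ?S x"
    then have \<beta>2: "\<beta>2 \<in> Cells \<Xi>" by blast
    show "(\<Sum>\<beta>1\<in>?S y. unit_vec \<beta>2 \<otimes>\<^sub>t f \<beta>1 \<beta>2 u \<otimes>\<^sub>t f \<beta> \<beta>1 v) =
        unit_vec \<beta>2 \<otimes>\<^sub>t fusion \<Xi> f f \<beta> \<beta>2 (u \<otimes>\<^sub>t v)"
      unfolding fusion_tens[where H = H and K = H, OF f f fin \<beta> \<beta>2 uv] by (rule tens_sum_right[symmetric])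
  qed
  finally show "act12 C (act23 C (assoc_right ((u \<otimes>\<^sub>t v) \<otimes>\<^sub>t unit_vec \<beta>))) =
    (\<Sum>\<beta>2\<in>?S x. unit_vec \<beta>2 \<otimes>\<^sub>t fusion \<Xi> f f \<beta> \<beta>2 (u \<otimes>\<^sub>t v))" .
qed

section \<open>Twisted operators on strings of arrows\<close>

lemma arrow_strings_generators:
  "arrow_strings G V = (\<lambda>x y. fv.span {in_deg \<alpha> v | \<alpha> v.
     \<alpha> \<in> Arr G \<and> src G \<alpha> = x \<and> tgt G \<alpha> = y \<and> v \<in> V \<alpha>})"
  by (intro ext) (simp only: arrow_strings_def)

lemma subspace_arrow_strings: "fv.subspace (arrow_strings G V x y)"
  by (simp add: arrow_strings_def)

lemma in_deg_in_arrow_strings: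
  "\<alpha> \<in> Arr G \<Longrightarrow> v \<in> V \<alpha> \<Longrightarrow> in_deg \<alpha> v \<in> arrow_strings G V (src G \<alpha>) (tgt G \<alpha>)"
  unfolding arrow_strings_def by (rule fv.span_base) blast

lemma arrow_strings_off_objects:
  assumes "groupoid G" "v \<in> arrow_strings G V x y" "x \<notin> Ob G"
  shows "v = 0"
proof -
  have "{in_deg \<alpha> v | \<alpha> v. \<alpha> \<in> Arr G \<and> src G \<alpha> = x \<and> tgt G \<alpha> = y \<and> v \<in> V \<alpha>} = {}"
    using groupoid.src_closed[OF assms(1)] assms(3) by blast
  then have "v \<in> fv.span {}" using assms(2) by (simp only: arrow_strings_def)
  then show ?thesis by (simp only: fv.span_empty singleton_iff)
qed

lemma arrow_strings2_generators:
  "arrow_strings G V \<odot> arrow_strings G V = (\<lambda>x z. fv.span {a \<otimes>\<^sub>t b | a b. \<exists>y.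
     a \<in> {in_deg \<alpha> v | \<alpha> v. \<alpha> \<in> Arr G \<and> src G \<alpha> = x \<and> tgt G \<alpha> = y \<and> v \<in> V \<alpha>} \<and>
     b \<in> {in_deg \<alpha> v | \<alpha> v. \<alpha> \<in> Arr G \<and> src G \<alpha> = y \<and> tgt G \<alpha> = z \<and> v \<in> V \<alpha>}})"
  unfolding arrow_strings_generators by (intro ext) (rule concat_tens_span)

text \<open>
  The degree of a string of arrows is its composite, which determines its source and its target.
\<close>

lemma degree_preserving_Hom:
  fixes G :: "('o, 'a) gpd" and V :: "'a \<Rightarrow> 'i tvec set"
  assumes G: "groupoid G"
  defines "E \<equiv> arrow_strings G V"
  assumes lin: "linear_on (tot (E \<odot> E)) R"
    and deg: "\<And>\<gamma>. \<gamma> \<in> Arr G \<Longrightarrow> R ` tens_deg G V \<gamma> \<subseteq> tens_deg G V \<gamma>"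
  shows "R \<in> Hom (E \<odot> E) (E \<odot> E)"
  unfolding E_def
proof (rule HomI[OF lin[unfolded E_def] arrow_strings2_generators _ subspace_concat])
  interpret groupoid G by (rule G)
  fix x z a assume "a \<in> {a \<otimes>\<^sub>t b | a b. \<exists>y.
     a \<in> {in_deg \<alpha> v | \<alpha> v. \<alpha> \<in> Arr G \<and> src G \<alpha> = x \<and> tgt G \<alpha> = y \<and> v \<in> V \<alpha>} \<and>
     b \<in> {in_deg \<alpha> v | \<alpha> v. \<alpha> \<in> Arr G \<and> src G \<alpha> = y \<and> tgt G \<alpha> = z \<and> v \<in> V \<alpha>}}"
  then obtain \<alpha> \<beta> v w where a: "a = in_deg \<alpha> v \<otimes>\<^sub>t in_deg \<beta> w"
    and \<alpha>\<beta>: "\<alpha> \<in> Arr G" "\<beta> \<in> Arr G" "tgt G \<alpha> = src G \<beta>"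
    and ends: "src G \<alpha> = x" "tgt G \<beta> = z" and vw: "v \<in> V \<alpha>" "w \<in> V \<beta>"
    by fastforce
  let ?\<gamma> = "cmp G \<beta> \<alpha>"
  have "a \<in> tens_deg G V ?\<gamma>"
    unfolding tens_deg_def a by (rule fv.span_base) (use \<alpha>\<beta> vw in blast)
  then have "R a \<in> tens_deg G V ?\<gamma>" using deg[OF cmp_closed[OF \<alpha>\<beta>]] by blast
  moreover have "tens_deg G V ?\<gamma> \<subseteq> (arrow_strings G V \<odot> arrow_strings G V) x z"
    unfolding tens_deg_def
  proof (rule fv.span_minimal[OF _ subspace_concat], clarify)
    fix \<alpha>' \<beta>' v' w'
    assume 1: "\<alpha>' \<in> Arr G" "\<beta>' \<in> Arr G" "tgt G \<alpha>' = src G \<beta>'" "cmp G \<beta>' \<alpha>' = ?\<gamma>"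
      and 2: "v' \<in> V \<alpha>'" "w' \<in> V \<beta>'"
    have "src G \<alpha>' = x" "tgt G \<beta>' = z"
      using src_cmp[OF 1(1-3)] src_cmp[OF \<alpha>\<beta>] tgt_cmp[OF 1(1-3)] tgt_cmp[OF \<alpha>\<beta>] 1(4) ends
      by simp_all
    then show "in_deg \<alpha>' v' \<otimes>\<^sub>t in_deg \<beta>' w' \<in> (arrow_strings G V \<odot> arrow_strings G V) x z"
      using tens_in_concat[where H = "arrow_strings G V" and K = "arrow_strings G V",
          OF in_deg_in_arrow_strings[where V = V, OF 1(1) 2(1)]]
        in_deg_in_arrow_strings[where V = V, OF 1(2) 2(2)] 1(3) by metis
  qed
  ultimately show "R a \<in> (arrow_strings G V \<odot> arrow_strings G V) x z" by blast
qed

lemma linear_on_proj2: "linear_on W (proj2 G c c')"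
  by (auto simp: linear_on_def proj2_def scl_def fun_eq_iff)

lemma proj2_component:
  assumes t: "t \<in> (arrow_strings G V \<odot> arrow_strings G V) x z"
  shows "proj2 G c c' t = (if c = x \<and> c' = z then t else 0)"
proof (rule linear_on_span_eq[OF linear_on_proj2 _ fv.subspace_UNIV subset_UNIV _
      t[unfolded arrow_strings2_generators]])
  show "linear_on UNIV (\<lambda>t. if c = x \<and> c' = z then t else 0)"
    by (auto simp: linear_on_def)
qed (auto simp: proj2_def tens_def in_deg_def fun_eq_iff)

text \<open>
  The projections of a string from \<open>c\<close> to \<open>c'\<close> to all other components are zero, so the infinite sum
  that assembles the operator has one term on it.
\<close>

lemma twisted_R_lhd_components:
  fixes G1 :: "('o1, 'a1) gpd" and V1 :: "'a1 \<Rightarrow> 'i1 tvec set"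
    and G2 :: "('o2, 'a2) gpd" and V2 :: "'a2 \<Rightarrow> 'i2 tvec set"
    and \<Xi> :: "('p, 'o1, 'o2) cells" and S :: "'p set"
    and Ct :: "('p, 'a1 \<times> 'i1, 'a2 \<times> 'i2) family"
    and R :: "(('a1 \<times> 'i1) \<times> ('a1 \<times> 'i1)) tvec \<Rightarrow> (('a1 \<times> 'i1) \<times> ('a1 \<times> 'i1)) tvec"
  defines "E \<equiv> arrow_strings G2 V2"
  defines "M \<equiv> \<lambda>c. twisted_R G1 V1 G2 V2 \<Xi> Ct R (conn \<Xi> S c) (conn \<Xi> S c)"
  assumes lin: "\<And>c c'. c \<in> Ob G2 \<Longrightarrow> linear_on (tot (E \<odot> E)) (M c c')"
  shows "linear_on (tot (E \<odot> E)) (twisted_R_lhd G1 V1 G2 V2 \<Xi> S Ct R)"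
    and "\<And>c c' t. c \<in> Ob G2 \<Longrightarrow> c' \<in> Ob G2 \<Longrightarrow> t \<in> (E \<odot> E) c c' \<Longrightarrow>
      twisted_R_lhd G1 V1 G2 V2 \<Xi> S Ct R t = M c c' t"
proof -
  let ?F = "\<lambda>(c, c') t. M c c' (proj2 G2 c c' t)" and ?O = "Ob G2 \<times> Ob G2"
  have L: "twisted_R_lhd G1 V1 G2 V2 \<Xi> S Ct R = (\<lambda>t. lsum ?O (\<lambda>b. ?F b t))"
    by (intro ext) (simp add: twisted_R_lhd_def M_def case_prod_beta')
  have proj: "proj2 G2 c c' t = (if c = x \<and> c' = z then t else 0)" if "t \<in> (E \<odot> E) x z" for c c' x z t
    using that unfolding E_def by (rule proj2_component)
  have zero: "?F b t = 0" if "t \<in> (E \<odot> E) x z" "b \<in> ?O" "b \<noteq> (x, z)" for x z t b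
  proof -
    obtain c c' where b: "b = (c, c')" by (cases b)
    then have "proj2 G2 c c' t = 0" using proj[OF that(1)] that(3) by auto
    then show ?thesis
      using linear_on_0[OF lin fv.subspace_0[OF subspace_tot]] that(2) b by auto
  qed
  have tot: "tot (E \<odot> E) = fv.span (\<Union>x z. (E \<odot> E) x z)" by (simp only: tot_def)
  have "linear_on (fv.span (\<Union>x z. (E \<odot> E) x z)) (\<lambda>t. lsum ?O (\<lambda>b. ?F b t))"
  proof (rule linear_on_lsum)
    fix b assume "b \<in> ?O"
    then obtain c c' where b: "b = (c, c')" "c \<in> Ob G2" by blast
    have "proj2 G2 c c' t \<in> tot (E \<odot> E)" if "t \<in> tot (E \<odot> E)" for t
    proof (rule linear_on_span_image[OF linear_on_proj2 fv.subspace_UNIV subset_UNIV subspace_tot _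
          that[unfolded tot]])
      fix s assume "s \<in> (\<Union>x z. (E \<odot> E) x z)"
      then obtain x z where s: "s \<in> (E \<odot> E) x z" by blast
      show "proj2 G2 c c' s \<in> tot (E \<odot> E)"
        unfolding proj[OF s]
        using in_tot[where H = "E \<odot> E", OF s] fv.subspace_0[OF subspace_tot[of "E \<odot> E"]]
        by presburger
    qed
    then have "proj2 G2 c c' ` tot (E \<odot> E) \<subseteq> tot (E \<odot> E)" by blast
    from linear_on_compose[OF linear_on_proj2 lin[OF b(2)] this]
    show "linear_on (fv.span (\<Union>x z. (E \<odot> E) x z)) (?F b)"
      unfolding b(1) tot by simp
  next
    fix t assume "t \<in> (\<Union>x z. (E \<odot> E) x z)"
    then obtain x z where t: "t \<in> (E \<odot> E) x z" by blast
    have "{b \<in> ?O. ?F b t \<noteq> 0} \<subseteq> {(x, z)}" using zero[OF t] by blast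
    then show "finite {b \<in> ?O. ?F b t \<noteq> 0}" by (rule finite_subset) simp
  qed
  then show "linear_on (tot (E \<odot> E)) (twisted_R_lhd G1 V1 G2 V2 \<Xi> S Ct R)"
    unfolding L tot .
  fix c c' t assume c: "c \<in> Ob G2" "c' \<in> Ob G2" and t: "t \<in> (E \<odot> E) c c'"
  have "lsum ?O (\<lambda>b. ?F b t) = (\<Sum>b\<in>{(c, c')}. ?F b t)"
    by (rule lsum_eq_sum) (use c zero[OF t] in auto)
  also have "\<dots> = M c c' t" using proj[OF t, of c c'] by simp
  finally show "twisted_R_lhd G1 V1 G2 V2 \<Xi> S Ct R t = M c c' t" unfolding L .
qed

text \<open>
  Linearity is needed on all strings of length two, also on those outside the component for which the
  operator is intended; there the inverse family is zero.
\<close>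

lemma linear_on_twisted_R:
  fixes G1 :: "('o1, 'a1) gpd" and V1 :: "'a1 \<Rightarrow> 'i1 tvec set"
    and G2 :: "('o2, 'a2) gpd" and V2 :: "'a2 \<Rightarrow> 'i2 tvec set"
    and Ct :: "('p, 'a1 \<times> 'i1, 'a2 \<times> 'i2) family"
  defines "E1 \<equiv> arrow_strings G1 V1" and "E2 \<equiv> arrow_strings G2 V2"
  assumes Ct: "Ct \<in> Fam \<Xi> E1 E2" and inv: "inverse_family G1 G2 \<Xi> E1 E2 Ct \<in> Fam_op \<Xi> E1 E2"
    and cells: "cell_set G1 G2 \<Xi>" and R: "R \<in> Hom (E1 \<odot> E1) (E1 \<odot> E1)"
    and b: "\<beta>1 \<in> Cells \<Xi>" "\<beta>2 \<in> Cells \<Xi>"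
  shows "linear_on (tot (E2 \<odot> E2)) (twisted_R G1 V1 G2 V2 \<Xi> Ct R \<beta>1 \<beta>2 c')"
proof -
  let ?g = "inverse_family G1 G2 \<Xi> E1 E2 Ct"
  note J = fusion_Fam[OF Ct Ct cell_fibres_finite(1)[OF cells]]
    and I = fusion_op_Fam_op[OF inv inv cell_fibres_finite(2)[OF cells]]
  have I_tot: "fusion_op \<Xi> ?g ?g \<beta>1 \<beta> ` tot (E2 \<odot> E2) \<subseteq> tot (E1 \<odot> E1)"
    if \<beta>: "\<beta> \<in> Cells \<Xi>" for \<beta>
  proof (rule image_subsetI, rule linear_on_span_image[OF Fam_op_linear[OF I b(1) \<beta>]
          subspace_tot _ subspace_tot])
    fix t assume "t \<in> tot (E2 \<odot> E2)"
    then show "t \<in> fv.span (\<Union>x z. (E2 \<odot> E2) x z)" by (simp only: tot_def)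
    show "(\<Union>x z. (E2 \<odot> E2) x z) \<subseteq> tot (E2 \<odot> E2)"
      unfolding tot_def by (rule fv.span_superset)
    fix s assume "s \<in> (\<Union>x z. (E2 \<odot> E2) x z)"
    then obtain x z where s: "s \<in> (E2 \<odot> E2) x z" by blast
    show "fusion_op \<Xi> ?g ?g \<beta>1 \<beta> s \<in> tot (E1 \<odot> E1)"
    proof (cases "x = ctgt \<Xi> \<beta>1 \<and> z = ctgt \<Xi> \<beta>")
      case True
      then show ?thesis using in_tot[where H = "E1 \<odot> E1", OF Fam_op_in[OF I b(1) \<beta>]] s by blast
    next
      case False
      then have "fusion_op \<Xi> ?g ?g \<beta>1 \<beta> s = 0"
        using Fam_op_zero[where K = "E2 \<odot> E2", OF I b(1) \<beta> s] by blast
      then show ?thesis using fv.subspace_0[OF subspace_tot[of "E1 \<odot> E1"]] by (simp only:)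
    qed
  qed
  have "linear_on (tot (E2 \<odot> E2)) (\<lambda>t. \<Sum>\<beta>\<in>{\<beta> \<in> Cells \<Xi>. ctgt \<Xi> \<beta> = c'}.
      fusion \<Xi> Ct Ct \<beta> \<beta>2 (R (fusion_op \<Xi> ?g ?g \<beta>1 \<beta> t)))"
  proof (rule linear_on_sum_maps)
    fix \<beta> assume "\<beta> \<in> {\<beta> \<in> Cells \<Xi>. ctgt \<Xi> \<beta> = c'}"
    then have \<beta>: "\<beta> \<in> Cells \<Xi>" by blast
    have "linear_on (tot (E1 \<odot> E1)) (\<lambda>t. fusion \<Xi> Ct Ct \<beta> \<beta>2 (R t))"
      by (rule linear_on_compose[OF Hom_linear[OF R] Fam_linear[OF J \<beta> b(2)] Hom_tot[OF R]])
    then show "linear_on (tot (E2 \<odot> E2))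
        (\<lambda>t. fusion \<Xi> Ct Ct \<beta> \<beta>2 (R (fusion_op \<Xi> ?g ?g \<beta>1 \<beta> t)))"
      by (rule linear_on_compose[OF Fam_op_linear[OF I b(1) \<beta>] _ I_tot[OF \<beta>]])
  qed
  then show ?thesis by (simp add: twisted_R_def[abs_def] Let_def E1_def E2_def)
qed

lemma conn_properties:
  assumes "connecting_system G2 \<Xi> S" "c \<in> Ob G2"
  shows "conn \<Xi> S c \<in> Cells \<Xi>" and "ctgt \<Xi> (conn \<Xi> S c) = c"
proof -
  have "\<exists>!\<beta>. \<beta> \<in> S \<and> ctgt \<Xi> \<beta> = c" and S: "S \<subseteq> Cells \<Xi>"
    using assms unfolding connecting_system_def by blast+
  from theI'[OF this(1)] show "conn \<Xi> S c \<in> Cells \<Xi>" "ctgt \<Xi> (conn \<Xi> S c) = c"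
    using S unfolding conn_def by blast+
qed

section \<open>The intertwining relation\<close>

theorem proposition4p16:
  fixes G1 :: "('o1, 'a1) gpd" and V1 :: "'a1 \<Rightarrow> 'i1 tvec set"
    and G2 :: "('o2, 'a2) gpd" and V2 :: "'a2 \<Rightarrow> 'i2 tvec set"
    and \<Xi> :: "('p, 'o1, 'o2) cells" and S :: "'p set" and P :: "complex set"
    and R1 :: "complex \<Rightarrow> (('a1 \<times> 'i1) \<times> ('a1 \<times> 'i1)) tvec \<Rightarrow> (('a1 \<times> 'i1) \<times> ('a1 \<times> 'i1)) tvec"
    and Ct :: "('p, 'a1 \<times> 'i1, 'a2 \<times> 'i2) family"
  assumes "groupoid G1" and "graded_space G1 V1"
    and "groupoid G2" and "graded_space G2 V2"
    and "cell_set G1 G2 \<Xi>"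
    and "yang_baxter_operator G1 V1 P R1"
    and "connecting_system G2 \<Xi> S" and "quasi_unique G2 V2 \<Xi> S"
    and "Ct \<in> Fam \<Xi> (arrow_strings G1 V1) (arrow_strings G2 V2)"
    and "cell_twist G1 V1 G2 V2 \<Xi> P R1 Ct"
  shows "let E1 = arrow_strings G1 V1; E2 = arrow_strings G2 V2; E\<pi> = cell_strings \<Xi> in
    \<exists>C \<in> Hom (E1 \<odot> E\<pi>) (E\<pi> \<odot> E2).
    (\<forall>\<alpha> \<in> Arr G1. \<forall>x \<in> V1 \<alpha>. \<forall>\<beta>1 \<in> Cells \<Xi>. tgt G1 \<alpha> = csrc \<Xi> \<beta>1 \<longrightarrow>
       C (in_deg \<alpha> x \<otimes>\<^sub>t unit_vec \<beta>1) =
       (\<Sum>\<beta>2 \<in> {\<beta>2 \<in> Cells \<Xi>. csrc \<Xi> \<beta>2 = src G1 \<alpha>}. unit_vec \<beta>2 \<otimes>\<^sub>t Ct \<beta>1 \<beta>2 (in_deg \<alpha> x))) \<and>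
    (\<forall>z. z \<notin> P \<longrightarrow> (\<forall>t \<in> tot (E1 \<odot> E1 \<odot> E\<pi>).
       act12 C (act23 C (act12 (R1 z) t)) =
       act23 (twisted_R_lhd G1 V1 G2 V2 \<Xi> S Ct (R1 z)) (act12 C (act23 C t))))"
proof -
  define E1 where "E1 = arrow_strings G1 V1"
  define E2 where "E2 = arrow_strings G2 V2"
  define E\<pi> where "E\<pi> = cell_strings \<Xi>"
  define C where "C = cell_intertwiner \<Xi> Ct"
  define g where "g = inverse_family G1 G2 \<Xi> E1 E2 Ct"
  let ?S = "\<lambda>x. {\<beta> \<in> Cells \<Xi>. csrc \<Xi> \<beta> = x}"
  note cells = \<open>cell_set G1 G2 \<Xi>\<close>
  note finS = cell_fibres_finite(1)[OF cells]
  have Ct: "Ct \<in> Fam \<Xi> E1 E2" using assms(9) by (simp only: E1_def E2_def)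
  have E1: "fv.subspace (E1 x y)" for x y
    unfolding E1_def by (rule subspace_arrow_strings)
  have E1_off: "v = 0" if "v \<in> E1 x y" "x \<notin> Ob G1" for v x y
    using arrow_strings_off_objects[OF assms(1)] that unfolding E1_def by blast
  have C: "C \<in> Hom (E1 \<odot> E\<pi>) (E\<pi> \<odot> E2)"
    unfolding C_def E\<pi>_def by (rule cell_intertwiner_Hom[OF Ct finS E1])
  note twist = assms(10)[unfolded cell_twist_def Let_def, folded E1_def E2_def]
  have "is_invertible G1 G2 \<Xi> E1 E2 Ct" using twist by blast
  then have inv: "is_inverse G1 G2 \<Xi> E1 E2 Ct g"
    unfolding is_invertible_def g_def inverse_family_def by (rule someI_ex)
  then have g: "g \<in> Fam_op \<Xi> E1 E2" unfolding is_inverse_def by blast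
  have formula: "C (in_deg \<alpha> x \<otimes>\<^sub>t unit_vec \<beta>1) =
      (\<Sum>\<beta>2 \<in> ?S (src G1 \<alpha>). unit_vec \<beta>2 \<otimes>\<^sub>t Ct \<beta>1 \<beta>2 (in_deg \<alpha> x))"
    if "\<alpha> \<in> Arr G1" "x \<in> V1 \<alpha>" "\<beta>1 \<in> Cells \<Xi>" for \<alpha> x \<beta>1
    unfolding C_def
    by (rule cell_intertwiner_tens[where H = E1, OF Ct finS _ that(3)])
      (unfold E1_def, rule in_deg_in_arrow_strings[where V = V1, OF that(1,2)])
  have "act12 C (act23 C (act12 (R1 z) t)) =
      act23 (twisted_R_lhd G1 V1 G2 V2 \<Xi> S Ct (R1 z)) (act12 C (act23 C t))"
    if z: "z \<notin> P" and t: "t \<in> tot (E1 \<odot> E1 \<odot> E\<pi>)" for z t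
  proof -
    define R where "R = R1 z"
    define L where "L = twisted_R_lhd G1 V1 G2 V2 \<Xi> S Ct R"
    define Tw where "Tw = twisted_R G1 V1 G2 V2 \<Xi> Ct R"
    have Tw: "Tw \<beta>1 \<beta>2 c' s = (\<Sum>\<beta> \<in> {\<beta> \<in> Cells \<Xi>. ctgt \<Xi> \<beta> = c'}.
        fusion \<Xi> Ct Ct \<beta> \<beta>2 (R (fusion_op \<Xi> g g \<beta>1 \<beta> s)))" for \<beta>1 \<beta>2 c' s
      by (simp only: Tw_def twisted_R_def Let_def g_def E1_def E2_def)
    have R: "R \<in> Hom (E1 \<odot> E1) (E1 \<odot> E1)"
      unfolding R_def E1_def
      by (rule degree_preserving_Hom[OF assms(1)])
        (use assms(6) z in \<open>unfold yang_baxter_operator_def Let_def, blast+\<close>)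
    have linTw: "linear_on (tot (E2 \<odot> E2)) (Tw (conn \<Xi> S c) (conn \<Xi> S c) c')"
      if "c \<in> Ob G2" for c c'
      unfolding Tw_def E2_def
      by (rule linear_on_twisted_R[OF Ct[unfolded E1_def E2_def] g[unfolded g_def E1_def E2_def] cells
            R[unfolded E1_def] conn_properties(1)[OF assms(7) that] conn_properties(1)[OF assms(7) that]])
    have L_lin: "linear_on (tot (E2 \<odot> E2)) L"
      unfolding L_def E2_def
      by (rule twisted_R_lhd_components(1)) (erule linTw[unfolded Tw_def E2_def])
    have L_component: "L s = Tw (conn \<Xi> S c) (conn \<Xi> S c) c' s"
      if "c \<in> Ob G2" "c' \<in> Ob G2" "s \<in> (E2 \<odot> E2) c c'" for c c' s
      unfolding L_def Tw_def
      by (rule twisted_R_lhd_components(2)[OF _ that(1,2) that(3)[unfolded E2_def]])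
        (erule linTw[unfolded Tw_def E2_def])
    have L: "L (fusion \<Xi> Ct Ct \<beta> \<beta>2 s) = fusion \<Xi> Ct Ct \<beta> \<beta>2 (R s)"
      if \<beta>: "\<beta> \<in> Cells \<Xi>" "\<beta>2 \<in> Cells \<Xi>" and s: "s \<in> (E1 \<odot> E1) (csrc \<Xi> \<beta>2) (csrc \<Xi> \<beta>)" for \<beta> \<beta>2 s
    proof -
      let ?c = "ctgt \<Xi> \<beta>2" and ?c' = "ctgt \<Xi> \<beta>"
      have c: "?c \<in> Ob G2" "?c' \<in> Ob G2" using cells \<beta> unfolding cell_set_def by blast+
      have Js: "fusion \<Xi> Ct Ct \<beta> \<beta>2 s \<in> (E2 \<odot> E2) ?c ?c'"
        by (rule Fam_in[OF fusion_Fam[OF Ct Ct finS] \<beta> s])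
      have "L (fusion \<Xi> Ct Ct \<beta> \<beta>2 s) = Tw (conn \<Xi> S ?c) (conn \<Xi> S ?c) ?c' (fusion \<Xi> Ct Ct \<beta> \<beta>2 s)"
        by (rule L_component[OF c Js])
      \<comment> \<open>The diagonal twisted operator depends on the cell only through its target,
        and the connecting cell over \<open>?c\<close> has the same target as \<open>\<beta>2\<close>.\<close>
      also have "\<dots> = Tw \<beta>2 \<beta>2 ?c' (fusion \<Xi> Ct Ct \<beta> \<beta>2 s)"
        using twist conn_properties[OF assms(7) c(1)] \<beta>(2) z c(2) Js unfolding Tw_def R_def by metis
      also have "\<dots> = fusion \<Xi> Ct Ct \<beta> \<beta>2 (R s)"
        unfolding Tw
      proof (rule twist_absorbs_fusion[OF Ct inv cells _ R \<beta> _ s])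
        show "v = 0" if "v \<in> E1 y z" "y \<notin> Ob G1" for y z v using E1_off[OF that] .
        \<comment> \<open>The off-diagonal twisted operators of a cell-twist vanish.\<close>
        fix \<beta>1 r assume "\<beta>1 \<in> Cells \<Xi>" "csrc \<Xi> \<beta>1 = csrc \<Xi> \<beta>2" "\<beta>1 \<noteq> \<beta>2"
          and "r \<in> (E2 \<odot> E2) (ctgt \<Xi> \<beta>1) ?c'"
        then have "Tw \<beta>1 \<beta>2 ?c' r = 0"
          using twist \<beta>(2) z c(2) unfolding Tw_def R_def by metis
        then show "(\<Sum>\<beta>'\<in>{\<beta>' \<in> Cells \<Xi>. ctgt \<Xi> \<beta>' = ?c'}.
            fusion \<Xi> Ct Ct \<beta>' \<beta>2 (R (fusion_op \<Xi> g g \<beta>1 \<beta>' r))) = 0" unfolding Tw .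
      qed
      finally show ?thesis .
    qed
    have D: "(\<lambda>t. act12 C (act23 C t)) \<in> Hom (E1 \<odot> E1 \<odot> E\<pi>) (E\<pi> \<odot> E2 \<odot> E2)"
      by (rule Hom_compose[OF act23_Hom[OF C] act12_Hom[OF C E1]])
    have R12: "act12 R \<in> Hom (E1 \<odot> E1 \<odot> E\<pi>) (E1 \<odot> E1 \<odot> E\<pi>)"
      by (rule act12_Hom[OF R E1])
    have L23: "linear_on (tot (E\<pi> \<odot> E2 \<odot> E2)) (act23 L)"
      unfolding act23_def by (rule linear_on_act_right[OF L_lin slice_right])
    \<comment> \<open>Both sides are linear in \<open>t\<close>, so \<open>t\<close> may be taken of the form \<open>u \<otimes>\<^sub>t v \<otimes>\<^sub>t e\<^sub>\<beta>\<close>.\<close>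
    note lhs = linear_on_compose[OF Hom_linear[OF R12] Hom_linear[OF D] Hom_tot[OF R12]]
    note rhs = linear_on_compose[OF Hom_linear[OF D] L23 Hom_tot[OF D]]
    define B where "B = (\<Union>x c. {u \<otimes>\<^sub>t s | u s. \<exists>y. u \<in> E1 x y \<and> s \<in> {v \<otimes>\<^sub>t e | v e. \<exists>y'.
      v \<in> E1 y y' \<and> e \<in> {unit_vec \<beta> | \<beta>. \<beta> \<in> Cells \<Xi> \<and> csrc \<Xi> \<beta> = y' \<and> ctgt \<Xi> \<beta> = c}}})"
    have tot: "tot (E1 \<odot> E1 \<odot> E\<pi>) = fv.span B"
    proof -
      have "E1 \<odot> E1 \<odot> E\<pi> = (\<lambda>x c. fv.span {u \<otimes>\<^sub>t s | u s. \<exists>y. u \<in> E1 x y \<and>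
          s \<in> {v \<otimes>\<^sub>t e | v e. \<exists>y'. v \<in> E1 y y' \<and>
            e \<in> {unit_vec \<beta> | \<beta>. \<beta> \<in> Cells \<Xi> \<and> csrc \<Xi> \<beta> = y' \<and> ctgt \<Xi> \<beta> = c}}})"
        unfolding E\<pi>_def concat_cell_generators[OF E1]
        by (intro ext) (rule concat_tens_span[where A = E1, unfolded span_components[of E1, OF E1]])
      then show ?thesis unfolding B_def by (simp only: tot_span)
    qed
    have "act12 C (act23 C (act12 R t)) = act23 L (act12 C (act23 C t))"
    proof (rule linear_on_span_eq[OF lhs rhs subspace_tot _ _ t[unfolded tot]])
      show "B \<subseteq> tot (E1 \<odot> E1 \<odot> E\<pi>)" unfolding tot by (rule fv.span_superset)
      fix b assume "b \<in> B"
      then obtain u v \<beta> x y where b: "b = u \<otimes>\<^sub>t v \<otimes>\<^sub>t unit_vec \<beta>" and \<beta>: "\<beta> \<in> Cells \<Xi>"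
        and uv: "u \<in> E1 x y" "v \<in> E1 y (csrc \<Xi> \<beta>)" unfolding B_def by blast
      define s where "s = u \<otimes>\<^sub>t v"
      have bs: "b = assoc_right (s \<otimes>\<^sub>t unit_vec \<beta>)" by (simp only: b s_def assoc_right_tens)
      have s: "s \<in> (E1 \<odot> E1) x (csrc \<Xi> \<beta>)"
        unfolding s_def by (rule tens_in_concat[where H = E1 and K = E1, OF uv])
      have Rs: "R s \<in> (E1 \<odot> E1) x (csrc \<Xi> \<beta>)" by (rule Hom_in[OF R s])
      note D_eq = double_intertwiner_fusion[OF Ct finS E1 \<beta>, folded C_def]
      have J: "fusion \<Xi> Ct Ct \<beta> \<beta>2 s \<in> (E2 \<odot> E2) (ctgt \<Xi> \<beta>2) (ctgt \<Xi> \<beta>)"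
        and LJ: "L (fusion \<Xi> Ct Ct \<beta> \<beta>2 s) = fusion \<Xi> Ct Ct \<beta> \<beta>2 (R s)"
        and \<beta>2': "\<beta>2 \<in> Cells \<Xi>" if "\<beta>2 \<in> ?S x" for \<beta>2
      proof -
        have \<beta>2: "\<beta>2 \<in> Cells \<Xi>" "csrc \<Xi> \<beta>2 = x" using that by blast+
        show "\<beta>2 \<in> Cells \<Xi>" by (rule \<beta>2)
        show "fusion \<Xi> Ct Ct \<beta> \<beta>2 s \<in> (E2 \<odot> E2) (ctgt \<Xi> \<beta>2) (ctgt \<Xi> \<beta>)"
          by (rule Fam_in[OF fusion_Fam[OF Ct Ct finS] \<beta> \<beta>2(1)]) (simp only: \<beta>2(2) s)
        show "L (fusion \<Xi> Ct Ct \<beta> \<beta>2 s) = fusion \<Xi> Ct Ct \<beta> \<beta>2 (R s)"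
          by (rule L[OF \<beta> \<beta>2(1)]) (simp only: \<beta>2(2) s)
      qed
      have "act12 C (act23 C (act12 R b)) = act12 C (act23 C (assoc_right (R s \<otimes>\<^sub>t unit_vec \<beta>)))"
        unfolding bs
        by (simp only: act12_tens[OF Hom_linear[OF R] in_tot[where H = "E1 \<odot> E1", OF s]])
      also have "\<dots> = (\<Sum>\<beta>2\<in>?S x. unit_vec \<beta>2 \<otimes>\<^sub>t fusion \<Xi> Ct Ct \<beta> \<beta>2 (R s))"
        by (rule D_eq[OF Rs])
      also have "\<dots> = (\<Sum>\<beta>2\<in>?S x. act23 L (unit_vec \<beta>2 \<otimes>\<^sub>t fusion \<Xi> Ct Ct \<beta> \<beta>2 s))"
      proof (rule sum.cong[OF refl])
        fix \<beta>2 assume \<beta>2: "\<beta>2 \<in> ?S x"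
        show "unit_vec \<beta>2 \<otimes>\<^sub>t fusion \<Xi> Ct Ct \<beta> \<beta>2 (R s) =
            act23 L (unit_vec \<beta>2 \<otimes>\<^sub>t fusion \<Xi> Ct Ct \<beta> \<beta>2 s)"
          unfolding act23_def act_right_tens[OF L_lin in_tot[where H = "E2 \<odot> E2", OF J[OF \<beta>2]]]
            LJ[OF \<beta>2] by (rule refl)
      qed
      also have "\<dots> = act23 L (\<Sum>\<beta>2\<in>?S x. unit_vec \<beta>2 \<otimes>\<^sub>t fusion \<Xi> Ct Ct \<beta> \<beta>2 s)"
      proof (rule linear_on_sum[OF L23 subspace_tot, symmetric])
        fix \<beta>2 assume \<beta>2: "\<beta>2 \<in> ?S x"
        show "unit_vec \<beta>2 \<otimes>\<^sub>t fusion \<Xi> Ct Ct \<beta> \<beta>2 s \<in> tot (E\<pi> \<odot> E2 \<odot> E2)"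
          by (rule in_tot[where H = "E\<pi> \<odot> E2 \<odot> E2",
                OF tens_in_concat[where H = E\<pi> and K = "E2 \<odot> E2",
                  OF unit_vec_in_cell_strings[OF \<beta>2'[OF \<beta>2], folded E\<pi>_def] J[OF \<beta>2]]])
      qed
      also have "\<dots> = act23 L (act12 C (act23 C b))" by (simp only: bs D_eq[OF s])
      finally show "act12 C (act23 C (act12 R b)) = act23 L (act12 C (act23 C b))" .
    qed
    then show ?thesis by (simp only: R_def L_def)
  qed
  then show ?thesis
    unfolding Let_def
    using C formula unfolding E1_def E2_def E\<pi>_def by blast
qed

end
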